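(* Let $\mu^*(s,w)$ be the optimal policy for the problem of minimizing $C_\mu(s)$ over $\mu\in\Pi$. If $Q\,\mathbf E[W]\le r$, then $\mu^*(s,w)$ is monotonically nondecreasing in both $s$ and $w$.
   Context: Model. Fix constants $r>0$ (storage ramp rate), $Q>0$ (Poisson arrival rate), $\theta>0$ (discount rate), $\bar s\in(0,\infty)$ (storage capacity), $B\in(0,\infty)$. Shocks arrive at the arrival times $0<t_1<t_2<\cdots$ of a Poisson process of rate $Q$; the shock sizes $W_1,W_2,\dots$ are i.i.d. with a distribution $f_W$ supported in $[0,B]$ and independent of the arrival times; $W$ denotes a generic random variable with distribution $f_W$. A (stationary Markov) policy is a measurable function $\mu:[0,\bar s]\times[0,B]\to\mathbb R$ with $0\le\mu(s,w)\le\min\{s,w\}$; the set of all policies is $\Pi$. Under policy $\mu$ from initial state $s_0=s\in[0,\bar s]$, the storage level $s_t\in[0,\bar s]$ increases at rate $r$ between arrivals until it reaches $\bar s$, where it stays until the next arrival, and at each arrival time $t_k$ it jumps down: $s_{t_k}=s_{t_k^-}-\mu(s_{t_k^-},W_k)$. The stage cost $g:[0,B]\to\mathbb R$ is bounded, strictly increasing, continuously differentiable, with $g(0)=0$ and $\mathbf E[g(W)]>0$; the setting is that of nonlinear but convex stage costs $g$. The cost of policy $\mu$ is $$C_\mu(s)=\mathbf E\Big[\sum_{k=1}^\infty e^{-\theta t_k}\,g\big(W_k-\mu(s_{t_k^-},W_k)\big)\,\Big|\,s_0=s\Big],$$ and the value function is $C(s)=\min_{\mu\in\Pi}C_\mu(s)$,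 $0\le s\le\bar s$. A policy $\mu^*\in\Pi$ is optimal if $\mu^*\in\arg\min_{\mu\in\Pi}C_\mu(s)$. Standing assumption: $C$ is continuously differentiable on $[0,\bar s]$.
   Formalization: Optimality fixes a policy only up to never-visited pairs (s,w), so: every optimal policy agrees almost surely along its trajectories with an optimal policy nondecreasing in s and w; one that also minimises the cost at each pair (s,w) is itself nondecreasing. *)

theory Defs
  imports "HOL-Probability.Probability"
begin

text \<open>
  Sequences are indexed from 0: \<open>T k\<close> and \<open>W k\<close> are the arrival time and the size of the
  shock number \<open>k + 1\<close>. Policies and stage costs are functions on the whole real line of which
  only the values on \<open>[0, sbar] \<times> [0, B]\<close> and on \<open>[0, B]\<close> matter.
\<close>

fun interarrival :: "(nat \<Rightarrow> 'a \<Rightarrow> real) \<Rightarrow> nat \<Rightarrow> 'a \<Rightarrow> real" where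
  "interarrival T 0 \<omega> = T 0 \<omega>"
| "interarrival T (Suc k) \<omega> = T (Suc k) \<omega> - T k \<omega>"

text \<open>
  A Poisson process of rate \<open>Q\<close> is given by its arrival times: the gaps are i.i.d. exponential
  of rate \<open>Q\<close>. The ordering \<open>0 < T 0 < T 1 < \<dots>\<close> holds surely, so that the storage level never
  leaves \<open>[0, sbar]\<close>.
\<close>

definition poisson_arrival_times :: "'a measure \<Rightarrow> real \<Rightarrow> (nat \<Rightarrow> 'a \<Rightarrow> real) \<Rightarrow> bool" where
  "poisson_arrival_times M Q T \<longleftrightarrow>
     prob_space.indep_vars M (\<lambda>_. borel) (interarrival T) UNIV \<and>
     (\<forall>k. distributed M lborel (interarrival T k) (\<lambda>x. ennreal (exponential_density Q x))) \<and>
     (\<forall>\<omega>\<in>space M. 0 < T 0 \<omega> \<and> (\<forall>k. T k \<omega> < T (Suc k) \<omega>))"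

definition iid_shocks ::
  "'a measure \<Rightarrow> real measure \<Rightarrow> real \<Rightarrow> (nat \<Rightarrow> 'a \<Rightarrow> real) \<Rightarrow> bool" where
  "iid_shocks M fW B W \<longleftrightarrow>
     prob_space.indep_vars M (\<lambda>_. borel) W UNIV \<and>
     (\<forall>k. distr M borel (W k) = fW) \<and>
     (\<forall>k. \<forall>\<omega>\<in>space M. W k \<omega> \<in> {0..B})"

text \<open>Continuous differentiability on a closed interval, one-sided at the end points.\<close>

definition continuously_differentiable_on :: "real set \<Rightarrow> (real \<Rightarrow> real) \<Rightarrow> bool" where
  "continuously_differentiable_on S f \<longleftrightarrow>
     (\<exists>f'. (\<forall>x\<in>S. (f has_real_derivative f' x) (at x within S)) \<and> continuous_on S f')"

definition policies :: "real \<Rightarrow> real \<Rightarrow> (real \<Rightarrow> real \<Rightarrow> real) set" where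
  "policies sbar B =
     {\<mu>. (\<lambda>(s, w). \<mu> s w) \<in> borel_measurable (restrict_space borel ({0..sbar} \<times> {0..B})) \<and>
         (\<forall>s\<in>{0..sbar}. \<forall>w\<in>{0..B}. 0 \<le> \<mu> s w \<and> \<mu> s w \<le> min s w)}"

text \<open>
  \<open>level_before r sbar \<mu> t w s k\<close> is the storage level just before arrival \<open>k\<close>, along arrival
  times \<open>t\<close> and shock sizes \<open>w\<close>, from initial level \<open>s\<close>: recharging at rate \<open>r\<close> with saturation
  at \<open>sbar\<close> takes level \<open>x\<close> to \<open>min sbar (x + r * d)\<close> after time \<open>d\<close>.
\<close>

fun level_before ::
  "real \<Rightarrow> real \<Rightarrow> (real \<Rightarrow> real \<Rightarrow> real) \<Rightarrow> (nat \<Rightarrow> real) \<Rightarrow> (nat \<Rightarrow> real) \<Rightarrow> real \<Rightarrow> nat \<Rightarrow> real"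
where
  "level_before r sbar \<mu> t w s 0 = min sbar (s + r * t 0)"
| "level_before r sbar \<mu> t w s (Suc k) =
     (let x = level_before r sbar \<mu> t w s k
      in min sbar (x - \<mu> x (w k) + r * (t (Suc k) - t k)))"

abbreviation random_level ::
  "real \<Rightarrow> real \<Rightarrow> (nat \<Rightarrow> 'a \<Rightarrow> real) \<Rightarrow> (nat \<Rightarrow> 'a \<Rightarrow> real) \<Rightarrow> (real \<Rightarrow> real \<Rightarrow> real) \<Rightarrow> real
     \<Rightarrow> nat \<Rightarrow> 'a \<Rightarrow> real" where
  "random_level r sbar T W \<mu> s k \<omega> \<equiv> level_before r sbar \<mu> (\<lambda>j. T j \<omega>) (\<lambda>j. W j \<omega>) s k"

definition policy_cost ::
  "'a measure \<Rightarrow> real \<Rightarrow> real \<Rightarrow> real \<Rightarrow> (real \<Rightarrow> real) \<Rightarrow> (nat \<Rightarrow> 'a \<Rightarrow> real) \<Rightarrow> (nat \<Rightarrow> 'a \<Rightarrow> real)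
     \<Rightarrow> (real \<Rightarrow> real \<Rightarrow> real) \<Rightarrow> real \<Rightarrow> real" where
  "policy_cost M r \<theta> sbar g T W \<mu> s =
     (LINT \<omega>|M. (\<Sum>k. exp (- \<theta> * T k \<omega>) *
        g (W k \<omega> - \<mu> (random_level r sbar T W \<mu> s k \<omega>) (W k \<omega>))))"

definition value_function ::
  "'a measure \<Rightarrow> real \<Rightarrow> real \<Rightarrow> real \<Rightarrow> real \<Rightarrow> (real \<Rightarrow> real)
     \<Rightarrow> (nat \<Rightarrow> 'a \<Rightarrow> real) \<Rightarrow> (nat \<Rightarrow> 'a \<Rightarrow> real) \<Rightarrow> real \<Rightarrow> real" where
  "value_function M r \<theta> sbar B g T W s =
     (INF \<mu>\<in>policies sbar B. policy_cost M r \<theta> sbar g T W \<mu> s)"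

text \<open>An optimal policy attains the minimum simultaneously for all initial levels.\<close>

definition optimal_policy ::
  "'a measure \<Rightarrow> real \<Rightarrow> real \<Rightarrow> real \<Rightarrow> real \<Rightarrow> (real \<Rightarrow> real)
     \<Rightarrow> (nat \<Rightarrow> 'a \<Rightarrow> real) \<Rightarrow> (nat \<Rightarrow> 'a \<Rightarrow> real) \<Rightarrow> (real \<Rightarrow> real \<Rightarrow> real) \<Rightarrow> bool" where
  "optimal_policy M r \<theta> sbar B g T W \<mu> \<longleftrightarrow>
     \<mu> \<in> policies sbar B \<and>
     (\<forall>s\<in>{0..sbar}.
        is_arg_min (\<lambda>\<mu>'. policy_cost M r \<theta> sbar g T W \<mu>' s) (\<lambda>\<mu>'. \<mu>' \<in> policies sbar B) \<mu>)"

text \<open>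
  The cost of a policy does not depend on its values at pairs \<open>(s, w)\<close> that are almost surely
  never met (Lebesgue-null sets of levels below \<open>sbar\<close>, shock sizes outside the support of
  \<open>fW\<close>), so optimality determines a policy only up to such pairs. Two notions make
  "the optimal policy" precise. Two policies are equivalent if, from every initial level,
  almost surely they prescribe the same decision at every arrival; the levels are those under
  the first policy, and they coincide almost surely with those under the second.
\<close>

definition equivalent_policies ::
  "'a measure \<Rightarrow> real \<Rightarrow> real \<Rightarrow> (nat \<Rightarrow> 'a \<Rightarrow> real) \<Rightarrow> (nat \<Rightarrow> 'a \<Rightarrow> real)
     \<Rightarrow> (real \<Rightarrow> real \<Rightarrow> real) \<Rightarrow> (real \<Rightarrow> real \<Rightarrow> real) \<Rightarrow> bool" where
  "equivalent_policies M r sbar T W \<mu> \<nu> \<longleftrightarrow>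
     (\<forall>s\<in>{0..sbar}. AE \<omega> in M. \<forall>k.
        \<mu> (random_level r sbar T W \<mu> s k \<omega>) (W k \<omega>) =
        \<nu> (random_level r sbar T W \<mu> s k \<omega>) (W k \<omega>))"

text \<open>
  The cost of a policy when a shock of size \<open>w\<close> hits at time 0 at level \<open>s\<close>, and the policies
  that minimise this cost at every single pair \<open>(s, w)\<close>.
\<close>

definition cost_at_shock ::
  "'a measure \<Rightarrow> real \<Rightarrow> real \<Rightarrow> real \<Rightarrow> (real \<Rightarrow> real) \<Rightarrow> (nat \<Rightarrow> 'a \<Rightarrow> real) \<Rightarrow> (nat \<Rightarrow> 'a \<Rightarrow> real)
     \<Rightarrow> (real \<Rightarrow> real \<Rightarrow> real) \<Rightarrow> real \<Rightarrow> real \<Rightarrow> real" where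
  "cost_at_shock M r \<theta> sbar g T W \<mu> s w =
     g (w - \<mu> s w) + policy_cost M r \<theta> sbar g T W \<mu> (s - \<mu> s w)"

definition optimal_at_every_shock ::
  "'a measure \<Rightarrow> real \<Rightarrow> real \<Rightarrow> real \<Rightarrow> real \<Rightarrow> (real \<Rightarrow> real)
     \<Rightarrow> (nat \<Rightarrow> 'a \<Rightarrow> real) \<Rightarrow> (nat \<Rightarrow> 'a \<Rightarrow> real) \<Rightarrow> (real \<Rightarrow> real \<Rightarrow> real) \<Rightarrow> bool" where
  "optimal_at_every_shock M r \<theta> sbar B g T W \<mu> \<longleftrightarrow>
     (\<forall>s\<in>{0..sbar}. \<forall>w\<in>{0..B}.
        is_arg_min (\<lambda>\<mu>'. cost_at_shock M r \<theta> sbar g T W \<mu>' s w)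
          (\<lambda>\<mu>'. \<mu>' \<in> policies sbar B) \<mu>)"

definition nondecreasing_policy :: "real \<Rightarrow> real \<Rightarrow> (real \<Rightarrow> real \<Rightarrow> real) \<Rightarrow> bool" where
  "nondecreasing_policy sbar B \<mu> \<longleftrightarrow>
     (\<forall>w\<in>{0..B}. mono_on {0..sbar} (\<lambda>s. \<mu> s w)) \<and>
     (\<forall>s\<in>{0..sbar}. mono_on {0..B} (\<lambda>w. \<mu> s w))"

end

theory Submission imports Defs begin

text \<open>
  Let \<open>J\<close> be the minimal expected discounted cost, as a function of the level just after a decision.
  It is a fixed point of the Bellman operator: wait for the next shock, then choose \<open>u\<close> to minimise
  \<open>g (w - u) + J (x - u)\<close>, where \<open>x\<close> and \<open>w\<close> are the refilled level and the shock. Both ingredients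
  of the operator preserve convexity and antitonicity. The minimisation does because
  \<open>(x, u) \<mapsto> g (w - u) + J (x - u)\<close> is convex on a convex set. The refill \<open>s \<mapsto> min sbar (s + r t)\<close>
  does because it is concave and an antitone convex function is applied to it. Hence \<open>J\<close> is convex
  and antitone (\<open>opt_value_candidate\<close>). It is even strictly convex
  (\<open>opt_value_strictly_convex\<close>): of two unequal levels, the saturation at \<open>sbar\<close> cuts off the refill
  of the higher one first, and with positive probability it cuts off the refill of their midpoint but
  not that of the lower one. Then the minimal cost is strictly larger at the lower refilled level,
  since \<open>J\<close> exceeds \<open>J sbar\<close> at every other level (\<open>opt_value_above_top\<close>).

  Strict convexity of \<open>J\<close> makes the minimising \<open>u\<close> unique. For an objective of the form
  \<open>g (w - u) + J (x - u)\<close> with convex summands, the standard exchange argument then gives that this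
  decision increases with \<open>x\<close> and with \<open>w\<close>, at a rate of at most 1 (\<open>greedy_mono_level\<close>,
  \<open>greedy_mono_shock\<close>). So it is continuous, and in particular a measurable policy.

  It remains to compare arbitrary policies with this one. Along the path of a policy, every decision
  costs some nonnegative excess over the minimum of \<open>g (w - u) + J (x - u)\<close>, and the cost of the
  policy is \<open>J s\<close> plus the expected discounted sum of these excesses (\<open>performance_difference\<close>, a
  telescoping sum in which the Bellman equation and the independence of each period from the past are
  used). The greedy policy has no excess, so it is optimal; any other optimal policy has almost
  surely no excess, so by uniqueness it almost surely takes the greedy decision at every arrival. If it
  is optimal at every single pair of level and shock, it equals the greedy policy everywhere.
\<close>

section \<open>Convexity, Lipschitz continuity and positive integrals\<close>

text \<open>
  Spreading two points apart while keeping their sum increases the sum of the values of a convex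
  function. This is the form of convexity on which every exchange argument below rests.
\<close>

lemma convex_on_four_points:
  fixes f :: "real \<Rightarrow> real"
  assumes f: "convex_on S f" and S: "a \<in> S" "d \<in> S" and "a \<le> b" "b \<le> d" "a + d = b + c"
  shows "f b + f c \<le> f a + f d"
proof (cases "a = d")
  case True
  with assms show ?thesis by auto
next
  case False
  define t where "t = (b - a) / (d - a)"
  have t: "0 \<le> t" "t \<le> 1" and b: "t * (d - a) = b - a"
    using False assms by (auto simp: t_def field_simps)
  have "b = (1 - t) * a + t * d" "c = (1 - (1 - t)) * a + (1 - t) * d"
    using b assms(6) by (auto simp: algebra_simps)
  then have "f b \<le> (1 - t) * f a + t * f d" "f c \<le> (1 - (1 - t)) * f a + (1 - t) * f d"
    using convex_onD[OF f, of t a d] convex_onD[OF f, of "1 - t" a d] t S by auto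
  then show ?thesis by (simp add: algebra_simps)
qed

lemma continuous_on_lipschitz_each:
  fixes f :: "real \<Rightarrow> real \<Rightarrow> real"
  assumes x: "\<And>x x' y. x \<in> A \<Longrightarrow> x' \<in> A \<Longrightarrow> y \<in> C \<Longrightarrow> x \<le> x' \<Longrightarrow> \<bar>f x y - f x' y\<bar> \<le> K * (x' - x)"
    and y: "\<And>x y y'. x \<in> A \<Longrightarrow> y \<in> C \<Longrightarrow> y' \<in> C \<Longrightarrow> y \<le> y' \<Longrightarrow> \<bar>f x y - f x y'\<bar> \<le> K * (y' - y)"
    and "0 \<le> K"
  shows "continuous_on (A \<times> C) (\<lambda>(x, y). f x y)"
proof -
  have x': "\<bar>f x y - f x' y\<bar> \<le> K * \<bar>x - x'\<bar>" if "x \<in> A" "x' \<in> A" "y \<in> C" for x x' y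
    using x[of x x' y] x[of x' x y] that by (cases "x \<le> x'") (auto simp: abs_minus_commute)
  have y': "\<bar>f x y - f x y'\<bar> \<le> K * \<bar>y - y'\<bar>" if "x \<in> A" "y \<in> C" "y' \<in> C" for x y y'
    using y[of x y y'] y[of x y' y] that by (cases "y \<le> y'") (auto simp: abs_minus_commute)
  have "(2 * K)-lipschitz_on (A \<times> C) (\<lambda>(x, y). f x y)"
  proof (rule lipschitz_onI)
    fix p q assume p: "p \<in> A \<times> C" "q \<in> A \<times> C"
    obtain a b c d where pq: "p = (a, b)" "q = (c, d)" by (cases p, cases q)
    have "\<bar>f a b - f c d\<bar> \<le> K * \<bar>a - c\<bar> + K * \<bar>b - d\<bar>"
      using x'[of a c b] y'[of c b d] p pq by auto
    also have "\<dots> \<le> K * dist p q + K * dist p q"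
      using dist_fst_le[of p q] dist_snd_le[of p q] \<open>0 \<le> K\<close>
      by (intro add_mono mult_left_mono) (auto simp: pq dist_real_def)
    finally show "dist (case p of (x, y) \<Rightarrow> f x y) (case q of (x, y) \<Rightarrow> f x y) \<le> 2 * K * dist p q"
      by (simp add: pq dist_real_def)
  qed (use \<open>0 \<le> K\<close> in auto)
  then show ?thesis by (rule lipschitz_on_continuous_on)
qed

lemma continuously_differentiable_lipschitz:
  assumes "continuously_differentiable_on {a..b} f"
  obtains L where "L-lipschitz_on {a..b} f"
proof -
  obtain f' where f': "\<And>x. x \<in> {a..b} \<Longrightarrow> (f has_real_derivative f' x) (at x within {a..b})"
    and cont: "continuous_on {a..b} f'"
    using assms unfolding continuously_differentiable_on_def by blast
  have "bounded (f' ` {a..b})"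
    using compact_continuous_image[OF cont] by (intro compact_imp_bounded) simp
  then obtain L where L: "0 < L" "\<And>x. x \<in> {a..b} \<Longrightarrow> norm (f' x) \<le> L"
    by (auto simp: bounded_pos)
  have "L-lipschitz_on {a..b} f"
  proof (rule lipschitz_onI)
    fix x y assume "x \<in> {a..b}" "y \<in> {a..b}"
    then show "dist (f x) (f y) \<le> L * dist x y"
      unfolding dist_norm by (intro field_differentiable_bound[OF _ f' L(2)]) auto
  qed (use L in simp)
  then show thesis by (rule that)
qed

text \<open>
  Stage costs, values and policies are controlled on an interval only, so measurability of a
  composition has to come from continuity there and from the range of the inner function.
\<close>

lemma borel_measurable_compose_on:
  fixes f :: "'b::topological_space \<Rightarrow> real"
  assumes "continuous_on A f" "h \<in> borel_measurable N" "\<And>\<omega>. \<omega> \<in> space N \<Longrightarrow> h \<omega> \<in> A"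
  shows "(\<lambda>\<omega>. f (h \<omega>)) \<in> borel_measurable N"
proof -
  have "h \<in> N \<rightarrow>\<^sub>M restrict_space borel A"
    using assms by (intro measurable_restrict_space2) auto
  from measurable_compose[OF this borel_measurable_continuous_on_restrict[OF assms(1)]]
  show ?thesis .
qed

text \<open>
  The form in which strict inequalities survive integration: it suffices that they hold on an event
  that is not null.
\<close>

lemma integral_pos_if_pos_somewhere:
  fixes f :: "'b \<Rightarrow> real"
  assumes "\<And>\<omega>. \<omega> \<in> space M \<Longrightarrow> 0 \<le> f \<omega>" and f: "integrable M f"
    and pos: "\<And>\<omega>. \<omega> \<in> space M \<Longrightarrow> P \<omega> \<Longrightarrow> 0 < f \<omega>" and P: "\<not> (AE \<omega> in M. \<not> P \<omega>)"
  shows "0 < (LINT \<omega>|M. f \<omega>)"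
proof (rule ccontr)
  assume "\<not> 0 < (LINT \<omega>|M. f \<omega>)"
  moreover have "0 \<le> (LINT \<omega>|M. f \<omega>)"
    using assms(1) by (rule Bochner_Integration.integral_nonneg)
  ultimately have "(LINT \<omega>|M. f \<omega>) = 0" by simp
  then have "AE \<omega> in M. f \<omega> = 0"
    using integral_nonneg_eq_0_iff_AE[OF f] assms(1) by (auto intro!: AE_I2)
  then have "AE \<omega> in M. \<not> P \<omega>"
    by (rule AE_mp) (use pos in \<open>fastforce intro!: AE_I2\<close>)
  with P show False by simp
qed

section \<open>The decision at a single shock\<close>

text \<open>
  The part of the model that involves no randomness. A Lipschitz constant of \<open>g\<close> is fixed because the
  same constant then serves for all functions of the level below.
\<close>

locale shock_response =
  fixes sbar B L :: real and g :: "real \<Rightarrow> real"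
  assumes sbar_pos: "0 < sbar" and B_pos: "0 < B"
    and g_convex: "convex_on {0..B} g"
    and g_strict_mono: "strict_mono_on {0..B} g"
    and g_zero: "g 0 = 0"
    and g_lipschitz: "L-lipschitz_on {0..B} g"
begin

definition cost_to_go :: "(real \<Rightarrow> real) \<Rightarrow> real \<Rightarrow> real \<Rightarrow> real \<Rightarrow> real" where
  "cost_to_go F s w u = g (w - u) + F (s - u)"

definition best_cost :: "(real \<Rightarrow> real) \<Rightarrow> real \<Rightarrow> real \<Rightarrow> real" where
  "best_cost F s w = (INF u\<in>{0..min s w}. cost_to_go F s w u)"

text \<open>
  The class of functions of the level that the Bellman operator preserves. It is closed under
  pointwise limits, which is why Lipschitz continuity with a fixed constant replaces continuity.
\<close>

definition regular :: "(real \<Rightarrow> real) \<Rightarrow> bool" where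
  "regular F \<longleftrightarrow> convex_on {0..sbar} F \<and> antimono_on {0..sbar} F \<and> L-lipschitz_on {0..sbar} F"

lemma L_nonneg: "0 \<le> L"
  using g_lipschitz by (rule lipschitz_on_nonneg)

lemma g_le: "x \<le> y \<Longrightarrow> 0 \<le> x \<Longrightarrow> y \<le> B \<Longrightarrow> g x \<le> g y"
  using g_strict_mono by (auto simp: strict_mono_on_def less_eq_real_def)

lemma g_less: "x < y \<Longrightarrow> 0 \<le> x \<Longrightarrow> y \<le> B \<Longrightarrow> g x < g y"
  using g_strict_mono by (auto simp: strict_mono_on_def)

lemma g_nonneg: "0 \<le> x \<Longrightarrow> x \<le> B \<Longrightarrow> 0 \<le> g x"
  using g_le[of 0 x] by (simp add: g_zero)

lemma g_growth: "x \<le> y \<Longrightarrow> 0 \<le> x \<Longrightarrow> y \<le> B \<Longrightarrow> g y \<le> g x + L * (y - x)"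
  using lipschitz_onD[OF g_lipschitz, of y x] by (auto simp: dist_real_def)

lemma regular_le: "regular F \<Longrightarrow> x \<le> y \<Longrightarrow> 0 \<le> x \<Longrightarrow> y \<le> sbar \<Longrightarrow> F y \<le> F x"
  by (auto simp: regular_def monotone_on_def)

lemma regular_growth:
  "regular F \<Longrightarrow> x \<le> y \<Longrightarrow> 0 \<le> x \<Longrightarrow> y \<le> sbar \<Longrightarrow> F x \<le> F y + L * (y - x)"
  using lipschitz_onD[of L "{0..sbar}" F x y] by (auto simp: dist_real_def regular_def)

lemma best_cost_attained:
  assumes F: "regular F" and s: "s \<in> {0..sbar}" and w: "w \<in> {0..B}"
  obtains u where "u \<in> {0..min s w}" "best_cost F s w = cost_to_go F s w u"
    "\<And>v. v \<in> {0..min s w} \<Longrightarrow> best_cost F s w \<le> cost_to_go F s w v"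
proof -
  have g: "continuous_on {0..B} g" and F': "continuous_on {0..sbar} F"
    using g_lipschitz F by (auto simp: regular_def intro: lipschitz_on_continuous_on)
  have "continuous_on {0..min s w} (cost_to_go F s w)"
    unfolding cost_to_go_def using s w
    by (intro continuous_intros continuous_on_compose2[OF g] continuous_on_compose2[OF F']) auto
  then obtain u where u: "u \<in> {0..min s w}"
      "\<And>v. v \<in> {0..min s w} \<Longrightarrow> cost_to_go F s w u \<le> cost_to_go F s w v"
    using continuous_attains_inf[of "{0..min s w}" "cost_to_go F s w"] s w by auto
  have "best_cost F s w = cost_to_go F s w u"
    unfolding best_cost_def using u by (intro cInf_eq_minimum) auto
  with u that show thesis by metis
qed

lemma best_cost_le:
  assumes "regular F" "s \<in> {0..sbar}" "w \<in> {0..B}" "0 \<le> u" "u \<le> s" "u \<le> w"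
  shows "best_cost F s w \<le> g (w - u) + F (s - u)"
  using assms by (metis best_cost_attained atLeastAtMost_iff cost_to_go_def min.boundedI)

lemma best_cost_decision:
  assumes "regular F" "s \<in> {0..sbar}" "w \<in> {0..B}"
  obtains u where "0 \<le> u" "u \<le> s" "u \<le> w" "best_cost F s w = g (w - u) + F (s - u)"
proof -
  obtain u where "u \<in> {0..min s w}" "best_cost F s w = cost_to_go F s w u"
    using best_cost_attained[OF assms] by metis
  then show thesis by (intro that[of u]) (simp_all add: cost_to_go_def)
qed

lemma best_cost_antimono_level:
  assumes F: "regular F" and "0 \<le> s" "s \<le> s'" "s' \<le> sbar" and w: "w \<in> {0..B}"
  shows "best_cost F s' w \<le> best_cost F s w"
proof -
  obtain u where u: "0 \<le> u" "u \<le> s" "u \<le> w" "best_cost F s w = g (w - u) + F (s - u)"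
    using best_cost_decision[OF F, of s w] assms by (metis atLeastAtMost_iff order_trans)
  with assms have "best_cost F s' w \<le> g (w - u) + F (s' - u)"
    by (intro best_cost_le[OF F]) auto
  moreover have "F (s' - u) \<le> F (s - u)"
    using assms u by (intro regular_le[OF F]) auto
  ultimately show ?thesis using u by simp
qed

text \<open>
  With less storage the same decision is kept as far as it is still feasible. Whatever it exceeds the
  lower level by becomes additional shortage, and both this and the drop of the remaining level cost
  at most \<open>L\<close> per unit.
\<close>

lemma best_cost_growth_level:
  assumes F: "regular F" and "0 \<le> s" "s \<le> s'" "s' \<le> sbar" and w: "w \<in> {0..B}"
  shows "best_cost F s w \<le> best_cost F s' w + L * (s' - s)"
proof -
  obtain u where u: "0 \<le> u" "u \<le> s'" "u \<le> w" "best_cost F s' w = g (w - u) + F (s' - u)"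
    using best_cost_decision[OF F, of s' w] assms by (metis atLeastAtMost_iff order_trans)
  show ?thesis
  proof (cases "u \<le> s")
    case True
    have "best_cost F s w \<le> g (w - u) + F (s - u)"
      using assms u True by (intro best_cost_le[OF F]) auto
    moreover have "F (s - u) \<le> F (s' - u) + L * ((s' - u) - (s - u))"
      using assms u True by (intro regular_growth[OF F]) auto
    ultimately show ?thesis using u by simp
  next
    case False
    have "best_cost F s w \<le> g (w - s) + F (s - s)"
      using assms u False by (intro best_cost_le[OF F]) auto
    moreover have "g (w - s) \<le> g (w - u) + L * ((w - s) - (w - u))"
      using assms u False by (intro g_growth) auto
    moreover have "F (s - s) \<le> F (s' - u) + L * ((s' - u) - (s - s))"
      using assms u False by (intro regular_growth[OF F]) auto
    ultimately show ?thesis using u by (simp add: algebra_simps)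
  qed
qed

lemma best_cost_mono_shock:
  assumes F: "regular F" and "0 \<le> w" "w \<le> w'" "w' \<le> B" and s: "s \<in> {0..sbar}"
  shows "best_cost F s w \<le> best_cost F s w'"
proof -
  obtain u where u: "0 \<le> u" "u \<le> s" "u \<le> w'" "best_cost F s w' = g (w' - u) + F (s - u)"
    using best_cost_decision[OF F, of s w'] assms by (metis atLeastAtMost_iff order_trans)
  define v where "v = min u w"
  have "best_cost F s w \<le> g (w - v) + F (s - v)"
    using assms u unfolding v_def by (intro best_cost_le[OF F]) auto
  moreover have "g (w - v) \<le> g (w' - u)"
    using assms u unfolding v_def by (intro g_le) auto
  moreover have "F (s - v) \<le> F (s - u)"
    using assms u unfolding v_def by (intro regular_le[OF F]) auto
  ultimately show ?thesis using u by simp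
qed

lemma best_cost_growth_shock:
  assumes F: "regular F" and "0 \<le> w" "w \<le> w'" "w' \<le> B" and s: "s \<in> {0..sbar}"
  shows "best_cost F s w' \<le> best_cost F s w + L * (w' - w)"
proof -
  obtain u where u: "0 \<le> u" "u \<le> s" "u \<le> w" "best_cost F s w = g (w - u) + F (s - u)"
    using best_cost_decision[OF F, of s w] assms by (metis atLeastAtMost_iff order_trans)
  have "best_cost F s w' \<le> g (w' - u) + F (s - u)"
    using assms u by (intro best_cost_le[OF F]) auto
  moreover have "g (w' - u) \<le> g (w - u) + L * ((w' - u) - (w - u))"
    using assms u by (intro g_growth) auto
  ultimately show ?thesis using u by simp
qed

lemma best_cost_continuous:
  assumes "regular F"
  shows "continuous_on ({0..sbar} \<times> {0..B}) (\<lambda>(s, w). best_cost F s w)"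
proof (rule continuous_on_lipschitz_each)
  show "\<bar>best_cost F s w - best_cost F s' w\<bar> \<le> L * (s' - s)"
    if "s \<in> {0..sbar}" "s' \<in> {0..sbar}" "w \<in> {0..B}" "s \<le> s'" for s s' w
    using best_cost_growth_level[OF assms, of s s' w] best_cost_antimono_level[OF assms, of s s' w] that by auto
  show "\<bar>best_cost F s w - best_cost F s w'\<bar> \<le> L * (w' - w)"
    if "s \<in> {0..sbar}" "w \<in> {0..B}" "w' \<in> {0..B}" "w \<le> w'" for s w w'
    using best_cost_growth_shock[OF assms, of w w' s] best_cost_mono_shock[OF assms, of w w' s] that by auto
qed (rule L_nonneg)

text \<open>
  Partial minimisation of a jointly convex function: a mixture of decisions is feasible for the mixed
  level.
\<close>

lemma best_cost_convex:
  assumes F: "regular F" and w: "w \<in> {0..B}"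
  shows "convex_on {0..sbar} (\<lambda>s. best_cost F s w)"
proof (rule convex_onI)
  fix t x y :: real
  assume t: "0 < t" "t < 1" and x: "x \<in> {0..sbar}" and y: "y \<in> {0..sbar}"
  obtain u where u: "0 \<le> u" "u \<le> x" "u \<le> w" "best_cost F x w = g (w - u) + F (x - u)"
    using best_cost_decision[OF F x w] .
  obtain v where v: "0 \<le> v" "v \<le> y" "v \<le> w" "best_cost F y w = g (w - v) + F (y - v)"
    using best_cost_decision[OF F y w] .
  let ?u = "(1 - t) * u + t * v" and ?x = "(1 - t) * x + t * y"
  have cx: "(1 - t) *\<^sub>R a + t *\<^sub>R b = (1 - t) * a + t * b" for a b :: real by simp
  have "?x \<in> {0..sbar}"
    using convexD_alt[of "{0..sbar}" x y t] x y t by simp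
  moreover have "?u \<le> ?x" "0 \<le> ?u"
    using u v t by (auto intro!: add_mono mult_left_mono)
  moreover have "?u \<le> w"
    using convexD_alt[of "{..w}" u v t] u v t by simp
  ultimately have "best_cost F ?x w \<le> g (w - ?u) + F (?x - ?u)"
    using w by (intro best_cost_le[OF F]) auto
  then have "best_cost F ?x w
      \<le> g ((1 - t) * (w - u) + t * (w - v)) + F ((1 - t) * (x - u) + t * (y - v))"
    by (simp add: algebra_simps)
  moreover have "g ((1 - t) * (w - u) + t * (w - v)) \<le> (1 - t) * g (w - u) + t * g (w - v)"
    using convex_onD[OF g_convex, of t "w - u" "w - v"] t u v w by simp
  moreover have "F ((1 - t) * (x - u) + t * (y - v)) \<le> (1 - t) * F (x - u) + t * F (y - v)"
    using convex_onD[of "{0..sbar}" F t "x - u" "y - v"] F t u v x y by (simp add: regular_def)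
  ultimately show "best_cost F ((1 - t) *\<^sub>R x + t *\<^sub>R y) w \<le> (1 - t) * best_cost F x w + t * best_cost F y w"
    using u v by (simp add: algebra_simps)
qed simp

text \<open>
  The minimum depends on the continuation cost monotonically and commutes with adding a constant;
  these are the two properties behind the contraction of the Bellman operator.
\<close>

lemma best_cost_perturb:
  assumes F: "regular F" and H: "regular H" and s: "s \<in> {0..sbar}" and w: "w \<in> {0..B}"
    and e: "\<And>x. x \<in> {0..sbar} \<Longrightarrow> F x \<le> H x + e"
  shows "best_cost F s w \<le> best_cost H s w + e"
proof -
  obtain u where u: "0 \<le> u" "u \<le> s" "u \<le> w" "best_cost H s w = g (w - u) + H (s - u)"
    using best_cost_decision[OF H s w] .
  have "best_cost F s w \<le> g (w - u) + F (s - u)"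
    using u s w by (intro best_cost_le[OF F]) auto
  moreover have "F (s - u) \<le> H (s - u) + e" using u s by (intro e) auto
  ultimately show ?thesis using u by simp
qed

lemma best_cost_nonneg:
  assumes F: "regular F" "\<And>x. x \<in> {0..sbar} \<Longrightarrow> 0 \<le> F x" and "s \<in> {0..sbar}" "w \<in> {0..B}"
  shows "0 \<le> best_cost F s w"
proof -
  obtain u where u: "0 \<le> u" "u \<le> s" "u \<le> w" "best_cost F s w = g (w - u) + F (s - u)"
    using best_cost_decision assms by blast
  then show ?thesis using g_nonneg[of "w - u"] F(2)[of "s - u"] assms by auto
qed

lemma best_cost_bound:
  assumes F: "regular F" "\<And>x. x \<in> {0..sbar} \<Longrightarrow> F x \<le> K" and "s \<in> {0..sbar}" "w \<in> {0..B}"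
  shows "best_cost F s w \<le> g B + K"
  using best_cost_le[of F s w 0] F(2)[of s] g_le[of w B] assms by fastforce

section \<open>Unique decisions are monotone\<close>

text \<open>
  Two different minimisers are refuted by their midpoint, so that is where strictness is asked for.
\<close>

definition strictly_midpoint_convex :: "(real \<Rightarrow> real) \<Rightarrow> bool" where
  "strictly_midpoint_convex F \<longleftrightarrow>
     (\<forall>x\<in>{0..sbar}. \<forall>y\<in>{0..sbar}. x < y \<longrightarrow> 2 * F ((x + y) / 2) < F x + F y)"

definition greedy :: "(real \<Rightarrow> real) \<Rightarrow> real \<Rightarrow> real \<Rightarrow> real" where
  "greedy F s w = (SOME u. u \<in> {0..min s w} \<and> cost_to_go F s w u = best_cost F s w)"

lemma greedy:
  assumes "regular F" "s \<in> {0..sbar}" "w \<in> {0..B}"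
  shows "0 \<le> greedy F s w" "greedy F s w \<le> s" "greedy F s w \<le> w"
    "g (w - greedy F s w) + F (s - greedy F s w) = best_cost F s w"
proof -
  have "\<exists>u. u \<in> {0..min s w} \<and> cost_to_go F s w u = best_cost F s w"
    using best_cost_attained[OF assms] by metis
  then have "greedy F s w \<in> {0..min s w} \<and> cost_to_go F s w (greedy F s w) = best_cost F s w"
    unfolding greedy_def by (rule someI_ex)
  then show "0 \<le> greedy F s w" "greedy F s w \<le> s" "greedy F s w \<le> w"
    "g (w - greedy F s w) + F (s - greedy F s w) = best_cost F s w"
    by (auto simp: cost_to_go_def)
qed

text \<open>
  Halfway between two minimisers the cost would be strictly smaller.
\<close>

lemma best_cost_unique_decision:
  assumes F: "regular F" "strictly_midpoint_convex F" and s: "s \<in> {0..sbar}" and w: "w \<in> {0..B}"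
    and u: "0 \<le> u" "u \<le> s" "u \<le> w" "g (w - u) + F (s - u) = best_cost F s w"
    and v: "0 \<le> v" "v \<le> s" "v \<le> w" "g (w - v) + F (s - v) = best_cost F s w"
  shows "u = v"
proof -
  have "\<not> u < v" if u: "0 \<le> u" "u \<le> s" "u \<le> w" "g (w - u) + F (s - u) = best_cost F s w"
    and v: "0 \<le> v" "v \<le> s" "v \<le> w" "g (w - v) + F (s - v) = best_cost F s w" for u v
  proof
    assume "u < v"
    define m where "m = (u + v) / 2"
    have "2 * g (w - m) \<le> g (w - v) + g (w - u)"
      using convex_on_four_points[OF g_convex, of "w - v" "w - u" "w - m" "w - m"] u v w \<open>u < v\<close>
      by (auto simp: m_def field_simps)
    moreover have "2 * F (s - m) < F (s - v) + F (s - u)"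
    proof -
      have "s - m = ((s - v) + (s - u)) / 2" by (simp add: m_def field_simps)
      moreover have "2 * F (((s - v) + (s - u)) / 2) < F (s - v) + F (s - u)"
        by (rule F(2)[unfolded strictly_midpoint_convex_def, rule_format]) (use u v s \<open>u < v\<close> in auto)
      ultimately show ?thesis by (simp only:)
    qed
    moreover have "best_cost F s w \<le> g (w - m) + F (s - m)"
      using F s w u v by (intro best_cost_le[OF F(1)]) (auto simp: m_def)
    ultimately show False using u v by linarith
  qed
  from this[OF u v] this[OF v u] show ?thesis by simp
qed

lemma greedy_less:
  assumes "regular F" "strictly_midpoint_convex F" "s \<in> {0..sbar}" "w \<in> {0..B}"
    and "0 \<le> v" "v \<le> s" "v \<le> w" "v \<noteq> greedy F s w"
  shows "g (w - greedy F s w) + F (s - greedy F s w) < g (w - v) + F (s - v)"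
  using best_cost_unique_decision[OF assms(1-4), of v "greedy F s w"] best_cost_le[OF assms(1,3,4), of v]
    greedy[OF assms(1,3,4)] assms(5-) by fastforce

text \<open>
  Exchange arguments. If the decision decreased with the level, then swapping the two decisions would
  not increase the total cost, since the remaining levels are moved together; if it increased faster
  than the level, the same happens after swapping the remaining levels, since then the shortages are
  moved together. Either contradicts the uniqueness of the minimisers.
\<close>

lemma greedy_mono_level:
  assumes F: "regular F" "strictly_midpoint_convex F" and s: "0 \<le> s" "s \<le> s'" "s' \<le> sbar"
    and w: "w \<in> {0..B}"
  shows "greedy F s w \<le> greedy F s' w" "greedy F s' w \<le> greedy F s w + (s' - s)"
proof -
  define u where "u = greedy F s w"
  define u' where "u' = greedy F s' w"
  have S: "s \<in> {0..sbar}" "s' \<in> {0..sbar}" using s by auto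
  note u = greedy(1-3)[OF F(1) S(1) w, folded u_def] and u' = greedy(1-3)[OF F(1) S(2) w, folded u'_def]
  note opt = greedy_less[OF F S(1) w, folded u_def] and opt' = greedy_less[OF F S(2) w, folded u'_def]
  have Fc: "convex_on {0..sbar} F" using F by (simp add: regular_def)
  show "u \<le> u'"
  proof (rule ccontr)
    assume "\<not> u \<le> u'"
    moreover from this have "F (s - u') + F (s' - u) \<le> F (s - u) + F (s' - u')"
      using u u' s by (intro convex_on_four_points[OF Fc]) auto
    ultimately show False using opt[of u'] opt'[of u] u u' s by auto
  qed
  show "u' \<le> u + (s' - s)"
  proof (rule ccontr)
    assume *: "\<not> u' \<le> u + (s' - s)"
    then have "g (w - (u' - (s' - s))) + g (w - (u + (s' - s))) \<le> g (w - u') + g (w - u)"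
      using u u' s w by (intro convex_on_four_points[OF g_convex]) auto
    moreover have "s - (u' - (s' - s)) = s' - u'" "s' - (u + (s' - s)) = s - u" by auto
    ultimately show False
      using opt[of "u' - (s' - s)"] opt'[of "u + (s' - s)"] u u' s * by auto
  qed
qed

text \<open>
  The mirror image of the previous lemma: swapping decisions moves the shortages together, and
  swapping shortages moves the remaining levels together.
\<close>

lemma greedy_mono_shock:
  assumes F: "regular F" "strictly_midpoint_convex F" and w: "0 \<le> w" "w \<le> w'" "w' \<le> B"
    and s: "s \<in> {0..sbar}"
  shows "greedy F s w \<le> greedy F s w'" "greedy F s w' \<le> greedy F s w + (w' - w)"
proof -
  define u where "u = greedy F s w"
  define u' where "u' = greedy F s w'"
  have W: "w \<in> {0..B}" "w' \<in> {0..B}" using w by auto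
  note u = greedy(1-3)[OF F(1) s W(1), folded u_def] and u' = greedy(1-3)[OF F(1) s W(2), folded u'_def]
  note opt = greedy_less[OF F s W(1), folded u_def] and opt' = greedy_less[OF F s W(2), folded u'_def]
  have Fc: "convex_on {0..sbar} F" using F by (simp add: regular_def)
  show "u \<le> u'"
  proof (rule ccontr)
    assume "\<not> u \<le> u'"
    moreover from this have "g (w - u') + g (w' - u) \<le> g (w - u) + g (w' - u')"
      using u u' w by (intro convex_on_four_points[OF g_convex]) auto
    ultimately show False using opt[of u'] opt'[of u] u u' w by auto
  qed
  show "u' \<le> u + (w' - w)"
  proof (rule ccontr)
    assume *: "\<not> u' \<le> u + (w' - w)"
    then have "F (s - (u' - (w' - w))) + F (s - (u + (w' - w))) \<le> F (s - u') + F (s - u)"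
      using u u' w s by (intro convex_on_four_points[OF Fc]) auto
    moreover have "w - (u' - (w' - w)) = w' - u'" "w' - (u + (w' - w)) = w - u" by auto
    ultimately show False
      using opt[of "u' - (w' - w)"] opt'[of "u + (w' - w)"] u u' w * by auto
  qed
qed

lemma greedy_policy:
  assumes F: "regular F" "strictly_midpoint_convex F"
  shows "greedy F \<in> policies sbar B"
proof -
  have "continuous_on ({0..sbar} \<times> {0..B}) (\<lambda>(s, w). greedy F s w)"
  proof (rule continuous_on_lipschitz_each[where K = 1])
    show "\<bar>greedy F s w - greedy F s' w\<bar> \<le> 1 * (s' - s)"
      if "s \<in> {0..sbar}" "s' \<in> {0..sbar}" "w \<in> {0..B}" "s \<le> s'" for s s' w
      using greedy_mono_level[OF F, of s s' w] that by auto
    show "\<bar>greedy F s w - greedy F s w'\<bar> \<le> 1 * (w' - w)"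
      if "s \<in> {0..sbar}" "w \<in> {0..B}" "w' \<in> {0..B}" "w \<le> w'" for s w w'
      using greedy_mono_shock[OF F, of w w' s] that by auto
  qed simp
  then have "(\<lambda>(s, w). greedy F s w) \<in> borel_measurable (restrict_space borel ({0..sbar} \<times> {0..B}))"
    by (rule borel_measurable_continuous_on_restrict)
  then show ?thesis
    using greedy[OF F(1)] by (auto simp: policies_def)
qed

lemma greedy_nondecreasing:
  assumes F: "regular F" "strictly_midpoint_convex F"
  shows "nondecreasing_policy sbar B (greedy F)"
  unfolding nondecreasing_policy_def
  using greedy_mono_level[OF F] greedy_mono_shock[OF F] by (auto intro!: mono_onI)

end

section \<open>The Bellman operator\<close>

text \<open>
  A period is the waiting time for a shock together with its size. The Bellman equation rests on the
  periods being independent and identically distributed. Strict convexity rests on the last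
  assumption: every open interval of nonnegative waiting times occurs, together with a shock of at
  least some fixed size, with positive probability.
\<close>

locale storage_process = shock_response sbar B L g + prob_space M
  for sbar B L :: real and g :: "real \<Rightarrow> real" and M :: "'a measure" +
  fixes X W :: "nat \<Rightarrow> 'a \<Rightarrow> real" and r \<theta> :: real
  assumes r_pos: "0 < r" and \<theta>_pos: "0 < \<theta>"
    and gap_pos: "\<omega> \<in> space M \<Longrightarrow> 0 < X k \<omega>"
    and shock_range: "\<omega> \<in> space M \<Longrightarrow> W k \<omega> \<in> {0..B}"
    and periods_indep:
      "indep_vars (\<lambda>_. borel \<Otimes>\<^sub>M borel) (\<lambda>k \<omega>. (X k \<omega>, W k \<omega>)) UNIV"
    and periods_identical:
      "distr M (borel \<Otimes>\<^sub>M borel) (\<lambda>\<omega>. (X k \<omega>, W k \<omega>)) =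
       distr M (borel \<Otimes>\<^sub>M borel) (\<lambda>\<omega>. (X 0 \<omega>, W 0 \<omega>))"
    and first_period_spread:
      "\<exists>w\<^sub>0>0. \<forall>a b. 0 \<le> a \<longrightarrow> a < b \<longrightarrow> \<not> (AE \<omega> in M. \<not> (a < X 0 \<omega> \<and> X 0 \<omega> < b \<and> w\<^sub>0 \<le> W 0 \<omega>))"
begin

lemma period_measurable [measurable]: "(\<lambda>\<omega>. (X k \<omega>, W k \<omega>)) \<in> M \<rightarrow>\<^sub>M borel \<Otimes>\<^sub>M borel"
  using periods_indep by (auto simp: indep_vars_def)

lemma gap_measurable [measurable]: "X k \<in> borel_measurable M"
  using measurable_compose[OF period_measurable measurable_fst, of k] by simp

lemma shock_measurable [measurable]: "W k \<in> borel_measurable M"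
  using measurable_compose[OF period_measurable measurable_snd, of k] by simp

definition refill :: "real \<Rightarrow> 'a \<Rightarrow> real" where
  "refill s \<omega> = min sbar (s + r * X 0 \<omega>)"

definition discount :: "'a \<Rightarrow> real" where
  "discount \<omega> = exp (- \<theta> * X 0 \<omega>)"

definition bellman :: "(real \<Rightarrow> real) \<Rightarrow> real \<Rightarrow> real" where
  "bellman F s = (LINT \<omega>|M. discount \<omega> * best_cost F (refill s \<omega>) (W 0 \<omega>))"

text \<open>
  The expected discount over one period, which is the contraction factor of the Bellman operator.
\<close>

definition \<rho> :: real where "\<rho> = (LINT \<omega>|M. discount \<omega>)"

text \<open>
  The discounted cost of leaving a shock of maximal size uncovered at every arrival; as
  \<open>\<rho> * (g B + cost_bound) = cost_bound\<close>, this bound is reproduced by the Bellman operator.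
\<close>

definition cost_bound :: real where "cost_bound = \<rho> * g B / (1 - \<rho>)"

definition candidate :: "(real \<Rightarrow> real) \<Rightarrow> bool" where
  "candidate F \<longleftrightarrow> regular F \<and> (\<forall>x\<in>{0..sbar}. 0 \<le> F x \<and> F x \<le> cost_bound)"

lemma refill_measurable [measurable]: "refill s \<in> borel_measurable M"
  unfolding refill_def by measurable

lemma discount_measurable [measurable]: "discount \<in> borel_measurable M"
  unfolding discount_def by measurable

lemma refill_range: "\<omega> \<in> space M \<Longrightarrow> s \<in> {0..sbar} \<Longrightarrow> refill s \<omega> \<in> {0..sbar}"
  using gap_pos[of \<omega> 0] r_pos sbar_pos by (auto simp: refill_def)

lemma refill_mono: "s \<le> s' \<Longrightarrow> refill s \<omega> \<le> refill s' \<omega>"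
  by (auto simp: refill_def)

lemma refill_nonexpansive: "s \<le> s' \<Longrightarrow> refill s' \<omega> \<le> refill s \<omega> + (s' - s)"
  by (auto simp: refill_def)

lemma refill_concave:
  assumes "0 \<le> t" "t \<le> 1"
  shows "(1 - t) * refill x \<omega> + t * refill y \<omega> \<le> refill ((1 - t) * x + t * y) \<omega>"
proof -
  have "(1 - t) * refill x \<omega> + t * refill y \<omega> \<le> (1 - t) * sbar + t * sbar"
    using assms by (intro add_mono mult_left_mono) (auto simp: refill_def)
  moreover have "(1 - t) * refill x \<omega> + t * refill y \<omega>
      \<le> (1 - t) * (x + r * X 0 \<omega>) + t * (y + r * X 0 \<omega>)"
    using assms by (intro add_mono mult_left_mono) (auto simp: refill_def)
  ultimately show ?thesis by (auto simp: refill_def algebra_simps)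
qed

lemma discount_range: "\<omega> \<in> space M \<Longrightarrow> 0 < discount \<omega>" "\<omega> \<in> space M \<Longrightarrow> discount \<omega> < 1"
  using gap_pos[of \<omega> 0] \<theta>_pos by (auto simp: discount_def)

lemma integrable_discount: "integrable M discount"
  by (rule integrable_const_bound[where B = 1])
     (auto intro!: AE_I2 discount_range less_imp_le simp: abs_of_pos discount_range)

lemma \<rho>_nonneg: "0 \<le> \<rho>"
  unfolding \<rho>_def by (intro integral_nonneg_AE AE_I2) (auto intro: less_imp_le discount_range)

lemma \<rho>_less_1: "\<rho> < 1"
proof -
  have "(LINT \<omega>|M. discount \<omega>) < (LINT \<omega>|M. 1)"
    by (rule integral_less_AE_space)
       (auto intro!: AE_I2 discount_range simp: integrable_discount emeasure_space_1)
  then show ?thesis by (simp add: \<rho>_def prob_space)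
qed

lemma cost_bound_nonneg: "0 \<le> cost_bound"
  using \<rho>_nonneg \<rho>_less_1 g_nonneg[of B] B_pos by (auto simp: cost_bound_def)

lemma cost_bound_fixed: "\<rho> * (g B + cost_bound) = cost_bound"
  using \<rho>_less_1 by (simp add: cost_bound_def field_simps)

lemma best_cost_measurable:
  assumes "regular F" "f \<in> borel_measurable N" "h \<in> borel_measurable N"
    and "\<And>\<omega>. \<omega> \<in> space N \<Longrightarrow> f \<omega> \<in> {0..sbar}" "\<And>\<omega>. \<omega> \<in> space N \<Longrightarrow> h \<omega> \<in> {0..B}"
  shows "(\<lambda>\<omega>. best_cost F (f \<omega>) (h \<omega>)) \<in> borel_measurable N"
  using borel_measurable_compose_on[OF best_cost_continuous[OF assms(1)], of "\<lambda>\<omega>. (f \<omega>, h \<omega>)" N] assms(2-)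
  by (simp add: borel_measurable_Pair)

lemma candidateD:
  assumes "candidate F"
  shows "regular F" "\<And>x. x \<in> {0..sbar} \<Longrightarrow> 0 \<le> F x" "\<And>x. x \<in> {0..sbar} \<Longrightarrow> F x \<le> cost_bound"
  using assms by (auto simp: candidate_def)

lemma best_cost_range:
  assumes "candidate F" "s \<in> {0..sbar}" "w \<in> {0..B}"
  shows "0 \<le> best_cost F s w" "best_cost F s w \<le> g B + cost_bound"
  using best_cost_nonneg[of F s w] best_cost_bound[of F cost_bound s w] candidateD[OF assms(1)] assms
  by auto

lemma best_cost_refill_measurable [measurable]:
  assumes "candidate F" "s \<in> {0..sbar}"
  shows "(\<lambda>\<omega>. best_cost F (refill s \<omega>) (W 0 \<omega>)) \<in> borel_measurable M"
  using assms refill_range shock_range by (intro best_cost_measurable candidateD) auto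

lemma integrable_bellman:
  assumes F: "candidate F" and s: "s \<in> {0..sbar}"
  shows "integrable M (\<lambda>\<omega>. discount \<omega> * best_cost F (refill s \<omega>) (W 0 \<omega>))"
proof (rule Bochner_Integration.integrable_bound)
  show "integrable M (\<lambda>\<omega>. discount \<omega> * (g B + cost_bound))"
    using integrable_discount by simp
  show "(\<lambda>\<omega>. discount \<omega> * best_cost F (refill s \<omega>) (W 0 \<omega>)) \<in> borel_measurable M"
    using assms by measurable
  show "AE \<omega> in M. norm (discount \<omega> * best_cost F (refill s \<omega>) (W 0 \<omega>))
      \<le> norm (discount \<omega> * (g B + cost_bound))"
  proof (rule AE_I2)
    fix \<omega> assume w: "\<omega> \<in> space M"
    have "\<bar>best_cost F (refill s \<omega>) (W 0 \<omega>)\<bar> \<le> \<bar>g B + cost_bound\<bar>"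
      using best_cost_range[OF F refill_range[OF w s] shock_range[OF w, of 0]] by simp
    then show "norm (discount \<omega> * best_cost F (refill s \<omega>) (W 0 \<omega>))
      \<le> norm (discount \<omega> * (g B + cost_bound))"
      by (simp add: abs_mult mult_left_mono)
  qed
qed

lemma bellman_le:
  assumes F: "candidate F" and s: "s \<in> {0..sbar}" and H: "candidate H" and s': "s' \<in> {0..sbar}"
    and le: "\<And>\<omega>. \<omega> \<in> space M \<Longrightarrow>
      best_cost F (refill s \<omega>) (W 0 \<omega>) \<le> best_cost H (refill s' \<omega>) (W 0 \<omega>) + e"
  shows "bellman F s \<le> bellman H s' + \<rho> * e"
proof -
  have "bellman F s \<le> (LINT \<omega>|M. discount \<omega> * best_cost H (refill s' \<omega>) (W 0 \<omega>) + discount \<omega> * e)"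
    unfolding bellman_def
  proof (rule integral_mono)
    fix \<omega> assume w: "\<omega> \<in> space M"
    show "discount \<omega> * best_cost F (refill s \<omega>) (W 0 \<omega>)
        \<le> discount \<omega> * best_cost H (refill s' \<omega>) (W 0 \<omega>) + discount \<omega> * e"
      using mult_left_mono[OF le[OF w], of "discount \<omega>"] discount_range[OF w]
      by (simp add: algebra_simps)
  qed (use integrable_bellman integrable_discount assms in auto)
  also have "\<dots> = bellman H s' + \<rho> * e"
    using integrable_bellman[OF H s'] integrable_discount by (simp add: bellman_def \<rho>_def)
  finally show ?thesis .
qed

lemma bellman_contraction:
  assumes "candidate F" "candidate H" "\<And>x. x \<in> {0..sbar} \<Longrightarrow> F x \<le> H x + e" "s \<in> {0..sbar}"
  shows "bellman F s \<le> bellman H s + \<rho> * e"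
  using assms best_cost_perturb candidateD refill_range shock_range by (intro bellman_le) auto

text \<open>
  Convexity is the delicate part: the refilled level is concave in the initial level, and composing it
  with the antitone convex minimal cost gives a convex function again.
\<close>

lemma bellman_candidate:
  assumes F: "candidate F"
  shows "candidate (bellman F)"
  unfolding candidate_def
proof (intro conjI ballI)
  have R: "regular F" using F by (simp add: candidate_def)
  have anti: "bellman F s' \<le> bellman F s" if "s \<in> {0..sbar}" "s' \<in> {0..sbar}" "s \<le> s'" for s s'
    using bellman_le[OF F that(2) F that(1), of 0] that best_cost_antimono_level[OF R]
      refill_mono[OF that(3)] refill_range shock_range by fastforce
  have growth: "bellman F s \<le> bellman F s' + L * (s' - s)"
    if s: "s \<in> {0..sbar}" "s' \<in> {0..sbar}" "s \<le> s'" for s s'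
  proof -
    have "bellman F s \<le> bellman F s' + \<rho> * (L * (s' - s))"
    proof (rule bellman_le[OF F s(1) F s(2)])
      fix \<omega> assume w: "\<omega> \<in> space M"
      have "best_cost F (refill s \<omega>) (W 0 \<omega>)
          \<le> best_cost F (refill s' \<omega>) (W 0 \<omega>) + L * (refill s' \<omega> - refill s \<omega>)"
        using refill_range[OF w s(1)] refill_range[OF w s(2)] shock_range[OF w] refill_mono[OF s(3)]
        by (intro best_cost_growth_level[OF R]) auto
      moreover have "L * (refill s' \<omega> - refill s \<omega>) \<le> L * (s' - s)"
        using refill_nonexpansive[OF s(3), of \<omega>] L_nonneg by (intro mult_left_mono) auto
      ultimately show "best_cost F (refill s \<omega>) (W 0 \<omega>)
          \<le> best_cost F (refill s' \<omega>) (W 0 \<omega>) + L * (s' - s)" by linarith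
    qed
    moreover have "\<rho> * (L * (s' - s)) \<le> 1 * (L * (s' - s))"
      using \<rho>_less_1 L_nonneg s by (intro mult_right_mono) auto
    ultimately show ?thesis by simp
  qed
  show "regular (bellman F)"
    unfolding regular_def
  proof (intro conjI)
    show "antimono_on {0..sbar} (bellman F)"
      using anti by (auto simp: monotone_on_def)
    show "L-lipschitz_on {0..sbar} (bellman F)"
    proof (rule lipschitz_onI[OF _ L_nonneg])
      fix s s' assume "s \<in> {0..sbar}" "s' \<in> {0..sbar}"
      then show "dist (bellman F s) (bellman F s') \<le> L * dist s s'"
        using anti[of s s'] growth[of s s'] anti[of s' s] growth[of s' s]
        by (cases "s \<le> s'") (auto simp: dist_real_def)
    qed
    show "convex_on {0..sbar} (bellman F)"
    proof (rule convex_onI)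
      fix t x y :: real
      assume t: "0 < t" "t < 1" and x: "x \<in> {0..sbar}" and y: "y \<in> {0..sbar}"
      let ?z = "(1 - t) * x + t * y"
      have z: "?z \<in> {0..sbar}"
        using convexD_alt[of "{0..sbar}" x y t] x y t by simp
      have "bellman F ?z \<le> (LINT \<omega>|M. (1 - t) * (discount \<omega> * best_cost F (refill x \<omega>) (W 0 \<omega>))
          + t * (discount \<omega> * best_cost F (refill y \<omega>) (W 0 \<omega>)))"
        unfolding bellman_def
      proof (rule integral_mono)
        fix \<omega> assume w: "\<omega> \<in> space M"
        let ?b = "\<lambda>s. best_cost F s (W 0 \<omega>)"
        note rx = refill_range[OF w x] and ry = refill_range[OF w y]
        let ?m = "(1 - t) * refill x \<omega> + t * refill y \<omega>"
        have "?m \<in> {0..sbar}"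
          using convexD_alt[of "{0..sbar}" "refill x \<omega>" "refill y \<omega>" t] rx ry t by simp
        then have "?b (refill ?z \<omega>) \<le> ?b ?m"
          using refill_range[OF w z] refill_concave[of t x \<omega> y] t shock_range[OF w]
          by (intro best_cost_antimono_level[OF R]) auto
        moreover have "?b ?m \<le> (1 - t) * ?b (refill x \<omega>) + t * ?b (refill y \<omega>)"
          using convex_onD[OF best_cost_convex[OF R shock_range[OF w]], of t "refill x \<omega>" "refill y \<omega>"] rx ry t
          by simp
        ultimately have "?b (refill ?z \<omega>) \<le> (1 - t) * ?b (refill x \<omega>) + t * ?b (refill y \<omega>)" by linarith
        from mult_left_mono[OF this, of "discount \<omega>"] discount_range[OF w]
        show "discount \<omega> * ?b (refill ?z \<omega>)
            \<le> (1 - t) * (discount \<omega> * ?b (refill x \<omega>)) + t * (discount \<omega> * ?b (refill y \<omega>))"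
          by (simp add: algebra_simps)
      qed (use integrable_bellman F x y z in auto)
      also have "\<dots> = (1 - t) * bellman F x + t * bellman F y"
        using integrable_bellman[OF F x] integrable_bellman[OF F y] by (simp add: bellman_def)
      finally show "bellman F ((1 - t) *\<^sub>R x + t *\<^sub>R y) \<le> (1 - t) * bellman F x + t * bellman F y"
        by simp
    qed simp
  qed
  fix s assume s: "s \<in> {0..sbar}"
  show "0 \<le> bellman F s"
    unfolding bellman_def
    using discount_range best_cost_range[OF F] refill_range[OF _ s] shock_range
    by (intro integral_nonneg_AE AE_I2 mult_nonneg_nonneg) (auto intro: less_imp_le)
  have "bellman F s \<le> (LINT \<omega>|M. discount \<omega> * (g B + cost_bound))"
    unfolding bellman_def
    using discount_range best_cost_range[OF F] refill_range[OF _ s] shock_range integrable_discount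
      integrable_bellman[OF F s]
    by (intro integral_mono mult_left_mono) (auto intro: less_imp_le)
  then show "bellman F s \<le> cost_bound"
    by (simp add: cost_bound_fixed flip: \<rho>_def)
qed

section \<open>The fixed point of the Bellman operator\<close>

definition value_iterate :: "nat \<Rightarrow> real \<Rightarrow> real" where
  "value_iterate n = (bellman ^^ n) (\<lambda>_. 0)"

definition opt_value :: "real \<Rightarrow> real" where
  "opt_value s = lim (\<lambda>n. value_iterate n s)"

lemma value_iterate_Suc: "value_iterate (Suc n) = bellman (value_iterate n)"
  by (simp add: value_iterate_def)

lemma value_iterate_candidate: "candidate (value_iterate n)"
proof (induction n)
  case 0
  show ?case
    using cost_bound_nonneg L_nonneg
    by (auto simp: value_iterate_def candidate_def regular_def convex_on_const monotone_on_def
        intro!: lipschitz_onI)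
next
  case (Suc n)
  then show ?case by (simp add: value_iterate_Suc bellman_candidate)
qed

text \<open>
  Iterating the contraction from 0 moves all later iterates together geometrically. The first gap is
  at most \<open>cost_bound\<close> because all iterates lie between 0 and that bound.
\<close>

lemma value_iterate_close:
  assumes "s \<in> {0..sbar}"
  shows "\<bar>value_iterate (n + p) s - value_iterate n s\<bar> \<le> \<rho> ^ n * cost_bound"
proof -
  have "value_iterate (n + p) s \<le> value_iterate n s + \<rho> ^ n * cost_bound \<and>
        value_iterate n s \<le> value_iterate (n + p) s + \<rho> ^ n * cost_bound"
    using assms
  proof (induction n arbitrary: s)
    case 0
    then show ?case
      using candidateD[OF value_iterate_candidate[of p]] cost_bound_nonneg by (simp add: value_iterate_def)
  next
    case (Suc n)
    then show ?case
      using bellman_contraction[OF value_iterate_candidate[of "n + p"] value_iterate_candidate[of n], of "\<rho> ^ n * cost_bound" s]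
        bellman_contraction[OF value_iterate_candidate[of n] value_iterate_candidate[of "n + p"], of "\<rho> ^ n * cost_bound" s]
      by (simp add: value_iterate_Suc mult.assoc)
  qed
  then show ?thesis by linarith
qed

lemma \<rho>_power_tendsto: "(\<lambda>n. \<rho> ^ n * c) \<longlonglongrightarrow> 0"
  using \<rho>_nonneg \<rho>_less_1 by (intro tendsto_mult_left_zero LIMSEQ_realpow_zero)

lemma value_iterate_tendsto:
  assumes s: "s \<in> {0..sbar}"
  shows "(\<lambda>n. value_iterate n s) \<longlonglongrightarrow> opt_value s"
proof -
  have "Cauchy (\<lambda>n. value_iterate n s)"
  proof (rule CauchyI')
    fix e :: real assume "0 < e"
    then obtain N where N: "\<rho> ^ N * cost_bound < e / 2"
      using order_tendstoD(2)[OF \<rho>_power_tendsto, of "e / 2" cost_bound]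
      by (auto simp: eventually_sequentially)
    have "dist (value_iterate m s) (value_iterate n s) < e" if "N \<le> m" "m < n" for m n
      using value_iterate_close[OF s, of N "m - N"] value_iterate_close[OF s, of N "n - N"] N that
      by (auto simp: dist_real_def)
    then show "\<exists>N. \<forall>m\<ge>N. \<forall>n>m. dist (value_iterate m s) (value_iterate n s) < e" by blast
  qed
  then show ?thesis
    unfolding opt_value_def by (metis Cauchy_convergent convergent_LIMSEQ_iff)
qed

lemma opt_value_close:
  assumes s: "s \<in> {0..sbar}"
  shows "\<bar>opt_value s - value_iterate n s\<bar> \<le> \<rho> ^ n * cost_bound"
proof (rule LIMSEQ_le_const2)
  show "(\<lambda>p. \<bar>value_iterate (p + n) s - value_iterate n s\<bar>) \<longlonglongrightarrow> \<bar>opt_value s - value_iterate n s\<bar>"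
    using value_iterate_tendsto[OF s] by (intro tendsto_intros LIMSEQ_ignore_initial_segment)
  show "\<exists>N. \<forall>p\<ge>N. \<bar>value_iterate (p + n) s - value_iterate n s\<bar> \<le> \<rho> ^ n * cost_bound"
    using value_iterate_close[OF s, of n] by (auto simp: add.commute)
qed

lemma opt_value_candidate: "candidate opt_value"
  unfolding candidate_def regular_def
proof (intro conjI ballI)
  note lim = value_iterate_tendsto
  have R: "regular (value_iterate n)" for n by (rule candidateD[OF value_iterate_candidate])
  show "convex_on {0..sbar} opt_value"
  proof (rule convex_onI)
    fix t x y :: real
    assume t: "0 < t" "t < 1" and xy: "x \<in> {0..sbar}" "y \<in> {0..sbar}"
    have z: "(1 - t) *\<^sub>R x + t *\<^sub>R y \<in> {0..sbar}"
      using convexD_alt[of "{0..sbar}" x y t] xy t by simp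
    have "(\<lambda>n. (1 - t) * value_iterate n x + t * value_iterate n y) \<longlonglongrightarrow> (1 - t) * opt_value x + t * opt_value y"
      using xy by (intro tendsto_intros lim)
    then show "opt_value ((1 - t) *\<^sub>R x + t *\<^sub>R y) \<le> (1 - t) * opt_value x + t * opt_value y"
      by (rule LIMSEQ_le[OF lim[OF z]])
        (use R convex_onD[of "{0..sbar}"] t xy in \<open>auto simp: regular_def\<close>)
  qed simp
  show "antimono_on {0..sbar} opt_value"
  proof (rule monotone_onI)
    fix x y assume "x \<in> {0..sbar}" "y \<in> {0..sbar}" "x \<le> y"
    then show "opt_value y \<le> opt_value x"
      by (intro LIMSEQ_le[OF lim lim]) (auto intro!: regular_le[OF R])
  qed
  show "L-lipschitz_on {0..sbar} opt_value"
  proof (rule lipschitz_onI[OF _ L_nonneg])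
    fix x y assume xy: "x \<in> {0..sbar}" "y \<in> {0..sbar}"
    have "(\<lambda>n. dist (value_iterate n x) (value_iterate n y)) \<longlonglongrightarrow> dist (opt_value x) (opt_value y)"
      using xy by (intro tendsto_intros lim)
    moreover have "dist (value_iterate n x) (value_iterate n y) \<le> L * dist x y" for n
      using R[of n] xy by (auto simp: regular_def dest: lipschitz_onD)
    ultimately show "dist (opt_value x) (opt_value y) \<le> L * dist x y"
      by (intro LIMSEQ_le_const2) auto
  qed
  fix x assume x: "x \<in> {0..sbar}"
  show "0 \<le> opt_value x"
    using candidateD[OF value_iterate_candidate] x by (intro LIMSEQ_le_const[OF lim[OF x]]) auto
  show "opt_value x \<le> cost_bound"
    using candidateD[OF value_iterate_candidate] x by (intro LIMSEQ_le_const2[OF lim[OF x]]) auto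
qed

lemma bellman_opt_value:
  assumes s: "s \<in> {0..sbar}"
  shows "bellman opt_value s = opt_value s"
proof -
  have "\<bar>bellman opt_value s - opt_value s\<bar> \<le> \<rho> ^ n * (2 * cost_bound)" for n
  proof -
    have "\<bar>opt_value x - value_iterate n x\<bar> \<le> \<rho> ^ n * cost_bound" if "x \<in> {0..sbar}" for x
      using opt_value_close[OF that] .
    then have *: "opt_value x \<le> value_iterate n x + \<rho> ^ n * cost_bound"
        "value_iterate n x \<le> opt_value x + \<rho> ^ n * cost_bound" if "x \<in> {0..sbar}" for x
      using that by fastforce+
    have "bellman opt_value s \<le> value_iterate (Suc n) s + \<rho> ^ Suc n * cost_bound"
      using bellman_contraction[OF opt_value_candidate value_iterate_candidate *(1) s]
      by (simp add: value_iterate_Suc mult.assoc)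
    moreover have "value_iterate (Suc n) s \<le> bellman opt_value s + \<rho> ^ Suc n * cost_bound"
      using bellman_contraction[OF value_iterate_candidate opt_value_candidate *(2) s]
      by (simp add: value_iterate_Suc mult.assoc)
    moreover have "\<rho> ^ Suc n * cost_bound \<le> \<rho> ^ n * cost_bound"
      using \<rho>_nonneg \<rho>_less_1 cost_bound_nonneg
      by (intro mult_right_mono) (auto simp: mult_left_le_one_le)
    ultimately show ?thesis using opt_value_close[OF s, of "Suc n"] by (auto simp: abs_le_iff)
  qed
  then have "\<bar>bellman opt_value s - opt_value s\<bar> \<le> 0"
    by (intro LIMSEQ_le_const[OF \<rho>_power_tendsto]) auto
  then show ?thesis by simp
qed

lemma opt_value_regular: "regular opt_value"
  by (rule candidateD[OF opt_value_candidate])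

section \<open>Strict convexity of the fixed point\<close>

text \<open>
  Unless the whole shock is covered, additional storage can be used to cover more of it without
  lowering the remaining level, which is strictly cheaper. So if a full storage brings no gain, then
  the shock is covered completely, and the continuation cost shows no gain either.
\<close>

lemma covered_if_no_gain_at_top:
  assumes F: "regular F" and x: "0 \<le> x" "x < sbar" and w: "0 < w" "w \<le> B"
    and le: "best_cost F x w \<le> best_cost F sbar w"
  shows "w \<le> x" "F (x - w) \<le> F (sbar - w)"
proof -
  obtain u where u: "0 \<le> u" "u \<le> x" "u \<le> w" "best_cost F x w = g (w - u) + F (x - u)"
    using best_cost_decision[OF F, of x w] x w by auto
  have "\<not> u < w"
  proof
    assume "u < w"
    define d where "d = min (sbar - x) (w - u)"
    have d: "0 < d" "d \<le> sbar - x" "d \<le> w - u" using \<open>u < w\<close> x by (auto simp: d_def)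
    have "best_cost F sbar w \<le> g (w - (u + d)) + F (sbar - (u + d))"
      using u d w x by (intro best_cost_le[OF F]) auto
    moreover have "g (w - (u + d)) < g (w - u)"
      using u d w by (intro g_less) auto
    moreover have "F (sbar - (u + d)) \<le> F (x - u)"
      using u d x by (intro regular_le[OF F]) auto
    ultimately show False using le u by linarith
  qed
  with u have [simp]: "u = w" by simp
  show "w \<le> x" using u by simp
  have "best_cost F sbar w \<le> g (w - w) + F (sbar - w)"
    using u w x by (intro best_cost_le[OF F]) auto
  then show "F (x - w) \<le> F (sbar - w)" using le u by simp
qed

text \<open>
  Slopes of a convex function increase, so an antitone one cannot decrease again once it has stopped
  decreasing.
\<close>

lemma regular_flat_tail:
  assumes F: "regular F" and "0 \<le> a" "a < b" "b \<le> sbar" and le: "F a \<le> F b"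
  shows "F a \<le> F sbar"
proof -
  define t where "t = (b - a) / (sbar - a)"
  have t: "0 < t" "t \<le> 1" "t * (sbar - a) = b - a" using assms by (auto simp: t_def field_simps)
  have "F ((1 - t) * a + t * sbar) \<le> (1 - t) * F a + t * F sbar"
    using convex_onD[of "{0..sbar}" F t a sbar] F t assms by (simp add: regular_def)
  moreover have "(1 - t) * a + t * sbar = b" using t by (simp add: algebra_simps)
  ultimately have "t * F a \<le> t * F sbar" using le by (simp add: algebra_simps)
  then show ?thesis using t by simp
qed

text \<open>
  Otherwise \<open>J\<close> would be flat on a maximal interval ending at \<open>sbar\<close>. Start at its left end \<open>q\<close>. By the
  Bellman equation, a full storage almost surely brings no gain over the refilled level, so by
  \<open>covered_if_no_gain_at_top\<close> the function would be flat already from the level that remains after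
  covering the shock. With positive probability the storage gains less than the size of the shock,
  and that level lies below \<open>q\<close>.
\<close>

lemma opt_value_above_top:
  assumes "0 \<le> p" "p < sbar"
  shows "opt_value sbar < opt_value p"
proof -
  let ?J = opt_value
  note R = opt_value_regular and C = opt_value_candidate
  have cont: "continuous_on {0..sbar} ?J"
    using R by (auto simp: regular_def intro: lipschitz_on_continuous_on)
  define A where "A = {x \<in> {0..sbar}. ?J x = ?J sbar}"
  have "closed A"
    unfolding A_def using continuous_closed_preimage_constant[OF cont] by simp
  then have "compact A"
    by (auto simp: compact_eq_bounded_closed A_def intro: bounded_subset[OF bounded_closed_interval[of 0 sbar]])
  moreover have "sbar \<in> A" using sbar_pos by (simp add: A_def)
  ultimately obtain q where q: "q \<in> A" "\<And>x. x \<in> A \<Longrightarrow> q \<le> x"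
    using compact_attains_inf[of A] by auto
  obtain w\<^sub>0 where w0: "0 < w\<^sub>0" "\<And>a b. 0 \<le> a \<Longrightarrow> a < b \<Longrightarrow>
      \<not> (AE \<omega> in M. \<not> (a < X 0 \<omega> \<and> X 0 \<omega> < b \<and> w\<^sub>0 \<le> W 0 \<omega>))"
    using first_period_spread by blast
  have qs: "q \<in> {0..sbar}" "?J q = ?J sbar" using q by (auto simp: A_def)
  have top: "sbar \<in> {0..sbar}" using sbar_pos by simp
  have "q = sbar"
  proof (rule ccontr)
    assume "q \<noteq> sbar"
    then have "q < sbar" using q by (simp add: A_def)
    \<comment> \<open>Within a waiting time shorter than \<open>b\<close>, the storage neither fills up nor gains as much as \<open>w\<^sub>0\<close>.\<close>
    define b where "b = min (sbar - q) w\<^sub>0 / r"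
    have b: "0 < b" using \<open>q < sbar\<close> w0 r_pos by (simp add: b_def)
    let ?f = "\<lambda>\<omega>. discount \<omega> * best_cost ?J (refill q \<omega>) (W 0 \<omega>)
                - discount \<omega> * best_cost ?J (refill sbar \<omega>) (W 0 \<omega>)"
    have "0 < (LINT \<omega>|M. ?f \<omega>)"
    proof (rule integral_pos_if_pos_somewhere[OF _ _ _ w0(2)[OF order_refl b]])
      show "integrable M ?f"
        using integrable_bellman[OF C] qs top by auto
      fix \<omega> assume w: "\<omega> \<in> space M"
      show "0 \<le> ?f \<omega>"
        using best_cost_antimono_level[OF R _ refill_mono[of q sbar \<omega>], of "W 0 \<omega>"] q
          refill_range[OF w qs(1)] refill_range[OF w top] shock_range[OF w] discount_range[OF w] qs
        by (auto intro!: mult_left_mono)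
      assume X: "0 < X 0 \<omega> \<and> X 0 \<omega> < b \<and> w\<^sub>0 \<le> W 0 \<omega>"
      then have "r * X 0 \<omega> < min (sbar - q) w\<^sub>0"
        using r_pos by (simp add: b_def pos_less_divide_eq mult.commute)
      then have x: "refill q \<omega> = q + r * X 0 \<omega>" "q + r * X 0 \<omega> < sbar" "r * X 0 \<omega> < w\<^sub>0"
        by (auto simp: refill_def)
      have xs: "refill sbar \<omega> = sbar" using X r_pos by (simp add: refill_def)
      have "\<not> best_cost ?J (refill q \<omega>) (W 0 \<omega>) \<le> best_cost ?J sbar (W 0 \<omega>)"
      proof
        assume "best_cost ?J (refill q \<omega>) (W 0 \<omega>) \<le> best_cost ?J sbar (W 0 \<omega>)"
        note cov = covered_if_no_gain_at_top[OF R _ _ _ _ this]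
        let ?y = "refill q \<omega> - W 0 \<omega>"
        have y: "0 \<le> ?y" "?J ?y \<le> ?J (sbar - W 0 \<omega>)"
          using cov refill_range[OF w qs(1)] x X w0(1) shock_range[OF w, of 0] by auto
        then have "?J ?y \<le> ?J sbar"
          using x shock_range[OF w, of 0] by (intro regular_flat_tail[OF R y(1) _ _ y(2)]) auto
        moreover have "?y \<le> sbar" using x shock_range[OF w, of 0] by auto
        ultimately have "?y \<in> A"
          using regular_le[OF R, of ?y sbar] y by (auto simp: A_def)
        from q(2)[OF this] show False using x X by simp
      qed
      then show "0 < ?f \<omega>" using discount_range[OF w] xs by simp
    qed
    also have "(LINT \<omega>|M. ?f \<omega>) = bellman ?J q - bellman ?J sbar"
      using integrable_bellman[OF C] qs top by (simp add: bellman_def)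
    finally show False using bellman_opt_value qs top by simp
  qed
  then have "p \<notin> A" using q(2)[of p] assms by auto
  then show ?thesis
    using assms regular_le[OF R, of p sbar] by (fastforce simp: A_def)
qed

lemma opt_value_strict:
  assumes "0 \<le> a" "a < b" "b \<le> sbar"
  shows "opt_value b < opt_value a"
  using regular_flat_tail[OF opt_value_regular assms] opt_value_above_top[of a] assms by fastforce

text \<open>
  Before taking expectations the midpoint inequality holds for each outcome. It is strict for waiting
  times after which the storage is full when started at the midpoint \<open>z\<close> and not yet full when
  started at \<open>x\<close>: then it compares the minimal costs at a full and at a nonfull storage.
\<close>

lemma opt_value_strictly_convex: "strictly_midpoint_convex opt_value"
  unfolding strictly_midpoint_convex_def
proof (intro ballI impI)
  let ?J = opt_value
  note R = opt_value_regular and C = opt_value_candidate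
  fix x y assume x: "x \<in> {0..sbar}" and y: "y \<in> {0..sbar}" and "x < y"
  define z where "z = (x + y) / 2"
  have z: "z \<in> {0..sbar}" "x < z" "z < y" using x y \<open>x < y\<close> by (auto simp: z_def)
  obtain w\<^sub>0 where w0: "0 < w\<^sub>0" "\<And>a b. 0 \<le> a \<Longrightarrow> a < b \<Longrightarrow>
      \<not> (AE \<omega> in M. \<not> (a < X 0 \<omega> \<and> X 0 \<omega> < b \<and> w\<^sub>0 \<le> W 0 \<omega>))"
    using first_period_spread by blast
  let ?h = "\<lambda>s \<omega>. discount \<omega> * best_cost ?J (refill s \<omega>) (W 0 \<omega>)"
  let ?f = "\<lambda>\<omega>. ?h x \<omega> + ?h y \<omega> - 2 * ?h z \<omega>"
  have "0 < (LINT \<omega>|M. ?f \<omega>)"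
  proof (rule integral_pos_if_pos_somewhere[OF _ _ _ w0(2)[of "(sbar - z) / r" "(sbar - x) / r"]])
    show "integrable M ?f"
      using integrable_bellman[OF C] x y z by auto
    show "0 \<le> (sbar - z) / r" "(sbar - z) / r < (sbar - x) / r"
      using z r_pos by (auto simp: divide_strict_right_mono)
    fix \<omega> assume w: "\<omega> \<in> space M"
    let ?b = "\<lambda>s. best_cost ?J s (W 0 \<omega>)"
    note rx = refill_range[OF w x] and ry = refill_range[OF w y] and rz = refill_range[OF w z(1)]
    have "2 * ?b (refill z \<omega>) \<le> ?b (refill x \<omega>) + ?b (refill y \<omega>)"
    proof -
      let ?m = "(refill x \<omega> + refill y \<omega>) / 2"
      have "?m \<le> refill z \<omega>"
        using refill_concave[of "1/2" x \<omega> y] by (simp add: z_def field_simps)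
      then have "?b (refill z \<omega>) \<le> ?b ?m"
        using rx ry rz shock_range[OF w] by (intro best_cost_antimono_level[OF R]) auto
      moreover have "?b ?m + ?b ?m \<le> ?b (refill x \<omega>) + ?b (refill y \<omega>)"
        using rx ry refill_mono[of x y \<omega>] \<open>x < y\<close>
        by (intro convex_on_four_points[OF best_cost_convex[OF R shock_range[OF w]]]) auto
      ultimately show ?thesis by linarith
    qed
    from mult_left_mono[OF this, of "discount \<omega>"] discount_range[OF w]
    show "0 \<le> ?f \<omega>" by (simp add: algebra_simps)
    assume X: "(sbar - z) / r < X 0 \<omega> \<and> X 0 \<omega> < (sbar - x) / r \<and> w\<^sub>0 \<le> W 0 \<omega>"
    then have "sbar - z < r * X 0 \<omega>" "r * X 0 \<omega> < sbar - x"
      using r_pos by (auto simp: field_simps)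
    then have e: "refill z \<omega> = sbar" "refill y \<omega> = sbar" "refill x \<omega> < sbar"
      using z by (auto simp: refill_def)
    have "\<not> ?b (refill x \<omega>) \<le> ?b sbar"
    proof
      assume "?b (refill x \<omega>) \<le> ?b sbar"
      note cov = covered_if_no_gain_at_top[OF R _ _ _ _ this]
      have "W 0 \<omega> \<le> refill x \<omega>" "?J (refill x \<omega> - W 0 \<omega>) \<le> ?J (sbar - W 0 \<omega>)"
        using cov rx e X w0(1) shock_range[OF w, of 0] by auto
      then show False
        using opt_value_strict[of "refill x \<omega> - W 0 \<omega>" "sbar - W 0 \<omega>"] e shock_range[OF w, of 0] by auto
    qed
    then show "0 < ?f \<omega>" using discount_range[OF w] e by (simp add: algebra_simps)
  qed
  also have "(LINT \<omega>|M. ?f \<omega>) = bellman ?J x + bellman ?J y - 2 * bellman ?J z"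
    using integrable_bellman[OF C] x y z by (simp add: bellman_def)
  finally show "2 * ?J ((x + y) / 2) < ?J x + ?J y"
    using bellman_opt_value x y z by (simp add: z_def)
qed

section \<open>Independence of a period from the past\<close>

definition periods :: "'a \<Rightarrow> nat \<Rightarrow> real \<times> real" where
  "periods \<omega> = (\<lambda>k. (X k \<omega>, W k \<omega>))"

text \<open>
  Paths are described as functions of the sequence \<open>z\<close> of periods, so that dependence on the past
  alone is dependence on finitely many coordinates.
\<close>

definition discount_to :: "(nat \<Rightarrow> real \<times> real) \<Rightarrow> nat \<Rightarrow> real" where
  "discount_to z n = exp (- \<theta> * (\<Sum>j<n. fst (z j)))"

primrec stock :: "(real \<Rightarrow> real \<Rightarrow> real) \<Rightarrow> real \<Rightarrow> (nat \<Rightarrow> real \<times> real) \<Rightarrow> nat \<Rightarrow> real" where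
  "stock \<mu> s z 0 = s"
| "stock \<mu> s z (Suc n) =
     (let x = min sbar (stock \<mu> s z n + r * fst (z n)) in x - \<mu> x (snd (z n)))"

lemma stock_cong: "(\<And>j. j < n \<Longrightarrow> z j = z' j) \<Longrightarrow> stock \<mu> s z n = stock \<mu> s z' n"
  by (induction n) auto

lemma discount_to_cong: "(\<And>j. j < n \<Longrightarrow> z j = z' j) \<Longrightarrow> discount_to z n = discount_to z' n"
  by (simp add: discount_to_def)

lemma discount_to_Suc: "discount_to z (Suc n) = discount_to z n * exp (- \<theta> * fst (z n))"
  by (simp add: discount_to_def algebra_simps flip: exp_add)

lemma stock_measurable:
  assumes [measurable]: "(\<lambda>p. \<mu> (fst p) (snd p)) \<in> borel_measurable (borel \<Otimes>\<^sub>M borel)" and "n \<le> N"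
  shows "(\<lambda>z. stock \<mu> s z n) \<in> borel_measurable (PiM {..<N} (\<lambda>_. borel \<Otimes>\<^sub>M borel))"
  using \<open>n \<le> N\<close>
proof (induction n)
  case (Suc n)
  then have [measurable]: "(\<lambda>z. stock \<mu> s z n) \<in> borel_measurable (PiM {..<N} (\<lambda>_. borel \<Otimes>\<^sub>M borel))"
    by simp
  have [measurable]: "(\<lambda>z. z n) \<in> PiM {..<N} (\<lambda>_. borel \<Otimes>\<^sub>M borel) \<rightarrow>\<^sub>M (borel \<Otimes>\<^sub>M borel :: (real \<times> real) measure)"
    using Suc by (intro measurable_component_singleton) auto
  let ?x = "\<lambda>z. min sbar (stock \<mu> s z n + r * fst (z n))"
  have "(\<lambda>z. (?x z, snd (z n))) \<in> PiM {..<N} (\<lambda>_. borel \<Otimes>\<^sub>M borel) \<rightarrow>\<^sub>M borel \<Otimes>\<^sub>M borel"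
    by measurable
  from measurable_compose[OF this assms(1)]
  have [measurable]: "(\<lambda>z. \<mu> (?x z) (snd (z n))) \<in> borel_measurable (PiM {..<N} (\<lambda>_. borel \<Otimes>\<^sub>M borel))"
    by simp
  show ?case by (simp add: Let_def)
qed simp

lemma discount_to_measurable:
  "(\<lambda>z. discount_to z n) \<in> borel_measurable (PiM {..<n} (\<lambda>_. borel \<Otimes>\<^sub>M borel))"
proof -
  have [measurable]: "(\<lambda>z. z j) \<in> PiM {..<n} (\<lambda>_. borel \<Otimes>\<^sub>M borel) \<rightarrow>\<^sub>M (borel \<Otimes>\<^sub>M borel :: (real \<times> real) measure)"
    if "j < n" for j
    using that by (intro measurable_component_singleton) auto
  have "(\<lambda>z. \<Sum>j<n. fst (z j)) \<in>
      borel_measurable (PiM {..<n} (\<lambda>_. borel \<Otimes>\<^sub>M borel :: (real \<times> real) measure))"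
    by (intro borel_measurable_sum) auto
  then show ?thesis unfolding discount_to_def by measurable
qed

lemma past_indep_period:
  assumes "(\<lambda>p. \<mu> (fst p) (snd p)) \<in> borel_measurable (borel \<Otimes>\<^sub>M borel)"
  shows "indep_var (borel \<Otimes>\<^sub>M borel) (\<lambda>\<omega>. (discount_to (periods \<omega>) n, stock \<mu> s (periods \<omega>) n))
    (borel \<Otimes>\<^sub>M borel) (\<lambda>\<omega>. periods \<omega> n)"
proof -
  let ?P = "\<lambda>A. PiM A (\<lambda>_::nat. borel \<Otimes>\<^sub>M borel :: (real \<times> real) measure)"
  have "indep_var (?P {..<n}) (\<lambda>\<omega>. restrict (periods \<omega>) {..<n}) (?P {n}) (\<lambda>\<omega>. restrict (periods \<omega>) {n})"
    using indep_var_restrict[OF periods_indep, of "{..<n}" "{n}"] by (simp add: periods_def)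
  moreover have "(\<lambda>z. (discount_to z n, stock \<mu> s z n)) \<in> ?P {..<n} \<rightarrow>\<^sub>M borel \<Otimes>\<^sub>M borel"
    using stock_measurable[OF assms order_refl] discount_to_measurable by (intro measurable_Pair)
  moreover have "(\<lambda>z. z n) \<in> ?P {n} \<rightarrow>\<^sub>M borel \<Otimes>\<^sub>M borel"
    by (intro measurable_component_singleton) auto
  ultimately have "indep_var (borel \<Otimes>\<^sub>M borel)
      ((\<lambda>z. (discount_to z n, stock \<mu> s z n)) \<circ> (\<lambda>\<omega>. restrict (periods \<omega>) {..<n}))
      (borel \<Otimes>\<^sub>M borel) ((\<lambda>z. z n) \<circ> (\<lambda>\<omega>. restrict (periods \<omega>) {n}))"
    by (rule indep_var_compose)
  moreover have "(\<lambda>z. (discount_to z n, stock \<mu> s z n)) \<circ> (\<lambda>\<omega>. restrict (periods \<omega>) {..<n})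
      = (\<lambda>\<omega>. (discount_to (periods \<omega>) n, stock \<mu> s (periods \<omega>) n))"
    by (auto simp: fun_eq_iff intro!: stock_cong discount_to_cong)
  moreover have "(\<lambda>z. z n) \<circ> (\<lambda>\<omega>. restrict (periods \<omega>) {n}) = (\<lambda>\<omega>. periods \<omega> n)"
    by auto
  ultimately show ?thesis by simp
qed

lemma discount_to_range:
  "\<omega> \<in> space M \<Longrightarrow> 0 < discount_to (periods \<omega>) n" "\<omega> \<in> space M \<Longrightarrow> discount_to (periods \<omega>) n \<le> 1"
proof -
  assume "\<omega> \<in> space M"
  then have "0 \<le> (\<Sum>j<n. X j \<omega>)" using gap_pos by (intro sum_nonneg) (auto intro: less_imp_le)
  then show "discount_to (periods \<omega>) n \<le> 1"
    using \<theta>_pos by (simp add: discount_to_def periods_def)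
qed (simp add: discount_to_def)

lemma periods_measurable [measurable]: "(\<lambda>\<omega>. periods \<omega> n) \<in> M \<rightarrow>\<^sub>M borel \<Otimes>\<^sub>M borel"
  using period_measurable by (simp add: periods_def)

text \<open>
  The Markov property: given the past, the next period is distributed like the first one. By
  independence the joint distribution is a product, and Fubini's theorem applies.
\<close>

lemma expectation_next_period:
  assumes \<mu>: "(\<lambda>p. \<mu> (fst p) (snd p)) \<in> borel_measurable (borel \<Otimes>\<^sub>M borel)"
    and \<phi> [measurable]: "(\<lambda>p. \<phi> (fst p) (snd p)) \<in> borel_measurable (borel \<Otimes>\<^sub>M (borel \<Otimes>\<^sub>M borel))"
    and bound: "\<And>y p. \<bar>\<phi> y p\<bar> \<le> K"
  shows "(LINT \<omega>|M. discount_to (periods \<omega>) n * \<phi> (stock \<mu> s (periods \<omega>) n) (periods \<omega> n)) =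
    (LINT \<omega>|M. discount_to (periods \<omega>) n * (LINT \<omega>'|M. \<phi> (stock \<mu> s (periods \<omega>) n) (periods \<omega>' 0)))"
proof -
  let ?U = "\<lambda>\<omega>. (discount_to (periods \<omega>) n, stock \<mu> s (periods \<omega>) n)" and ?V = "\<lambda>\<omega>. periods \<omega> n"
  let ?B = "borel \<Otimes>\<^sub>M borel :: (real \<times> real) measure"
  let ?f = "\<lambda>(u, v). fst u * \<phi> (snd u) v"
  note ind = past_indep_period[OF \<mu>, of n s]
  have [measurable]: "?U \<in> M \<rightarrow>\<^sub>M ?B" "?V \<in> M \<rightarrow>\<^sub>M ?B"
    using indep_var_rv1[OF ind] indep_var_rv2[OF ind] by auto
  interpret U: prob_space "distr M ?B ?U" by (rule prob_space_distr) measurable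
  interpret V: prob_space "distr M ?B ?V" by (rule prob_space_distr) measurable
  interpret P: pair_sigma_finite "distr M ?B ?U" "distr M ?B ?V" ..
  have f [measurable]: "?f \<in> borel_measurable (?B \<Otimes>\<^sub>M ?B)"
  proof -
    have "(\<lambda>q. (snd (fst q), snd q)) \<in> ?B \<Otimes>\<^sub>M ?B \<rightarrow>\<^sub>M borel \<Otimes>\<^sub>M ?B" by measurable
    from measurable_compose[OF this \<phi>]
    have [measurable]: "(\<lambda>q. \<phi> (snd (fst q)) (snd q)) \<in> borel_measurable (?B \<Otimes>\<^sub>M ?B)" by simp
    have "(\<lambda>q. fst (fst q) * \<phi> (snd (fst q)) (snd q)) \<in> borel_measurable (?B \<Otimes>\<^sub>M ?B)" by measurable
    then show ?thesis by (simp add: case_prod_beta)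
  qed
  have eq: "distr M ?B ?U \<Otimes>\<^sub>M distr M ?B ?V = distr M (?B \<Otimes>\<^sub>M ?B) (\<lambda>\<omega>. (?U \<omega>, ?V \<omega>))"
    using ind indep_var_distribution_eq by blast
  have int: "integrable M (\<lambda>\<omega>. ?f (?U \<omega>, ?V \<omega>))"
  proof (rule integrable_const_bound[where B = K])
    show "AE \<omega> in M. norm (?f (?U \<omega>, ?V \<omega>)) \<le> K"
    proof (rule AE_I2)
      fix \<omega> assume w: "\<omega> \<in> space M"
      have "\<bar>discount_to (periods \<omega>) n\<bar> * \<bar>\<phi> (stock \<mu> s (periods \<omega>) n) (periods \<omega> n)\<bar> \<le> 1 * K"
        using discount_to_range[OF w, of n] bound by (intro mult_mono) auto
      then show "norm (?f (?U \<omega>, ?V \<omega>)) \<le> K" by (simp add: abs_mult)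
    qed
  qed measurable
  have "(LINT \<omega>|M. ?f (?U \<omega>, ?V \<omega>)) = integral\<^sup>L (distr M (?B \<Otimes>\<^sub>M ?B) (\<lambda>\<omega>. (?U \<omega>, ?V \<omega>))) ?f"
    by (rule integral_distr[symmetric]) measurable
  also have "\<dots> = integral\<^sup>L (distr M ?B ?U \<Otimes>\<^sub>M distr M ?B ?V) ?f" by (simp only: eq)
  also have "\<dots> = (LINT u|distr M ?B ?U. LINT v|distr M ?B ?V. ?f (u, v))"
  proof (rule P.integral_fst'[symmetric])
    show "integrable (distr M ?B ?U \<Otimes>\<^sub>M distr M ?B ?V) ?f"
      unfolding eq using int by (subst integrable_distr_eq) measurable
  qed
  also have "\<dots> = (LINT \<omega>|M. LINT v|distr M ?B ?V. ?f (?U \<omega>, v))"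
  proof (rule integral_distr)
    show "(\<lambda>u. LINT v|distr M ?B ?V. ?f (u, v)) \<in> borel_measurable ?B"
      using f by (intro V.borel_measurable_lebesgue_integral) (auto cong: measurable_cong_sets)
  qed measurable
  also have "\<dots> = (LINT \<omega>|M. discount_to (periods \<omega>) n * (LINT \<omega>'|M. \<phi> (stock \<mu> s (periods \<omega>) n) (periods \<omega>' 0)))"
  proof -
    have V: "distr M ?B ?V = distr M ?B (\<lambda>\<omega>. periods \<omega> 0)"
      using periods_identical by (simp add: periods_def)
    have "(LINT v|distr M ?B ?V. \<phi> y v) = (LINT \<omega>'|M. \<phi> y (periods \<omega>' 0))" for y
    proof -
      have "(\<lambda>v. (y, v)) \<in> ?B \<rightarrow>\<^sub>M borel \<Otimes>\<^sub>M ?B" by measurable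
      from measurable_compose[OF this \<phi>] have "\<phi> y \<in> borel_measurable ?B" by simp
      then show ?thesis unfolding V by (intro integral_distr) measurable
    qed
    then show ?thesis by simp
  qed
  finally show ?thesis by simp
qed

section \<open>The performance difference along a path\<close>

text \<open>
  Extending a policy by 0 makes it Borel measurable on the whole plane without changing any path.
\<close>

definition clip :: "(real \<Rightarrow> real \<Rightarrow> real) \<Rightarrow> real \<Rightarrow> real \<Rightarrow> real" where
  "clip \<mu> x w = (if (x, w) \<in> {0..sbar} \<times> {0..B} then \<mu> x w else 0)"

lemma clip_measurable:
  assumes "\<mu> \<in> policies sbar B"
  shows "(\<lambda>p. clip \<mu> (fst p) (snd p)) \<in> borel_measurable (borel \<Otimes>\<^sub>M borel)"
proof -
  have "(\<lambda>p. case_prod \<mu> p * indicat_real ({0..sbar} \<times> {0..B}) p) \<in> borel_measurable (borel :: (real \<times> real) measure)"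
    using assms borel_measurable_restrict_space_iff[of "{0..sbar} \<times> {0..B}" "borel :: (real \<times> real) measure" "case_prod \<mu>"]
    by (auto simp: policies_def borel_closed closed_Times mult.commute)
  also have "(\<lambda>p. case_prod \<mu> p * indicat_real ({0..sbar} \<times> {0..B}) p) = (\<lambda>p. clip \<mu> (fst p) (snd p))"
    by (auto simp: clip_def fun_eq_iff indicator_def)
  finally show ?thesis by (simp add: borel_prod)
qed

definition level :: "(real \<Rightarrow> real \<Rightarrow> real) \<Rightarrow> real \<Rightarrow> nat \<Rightarrow> 'a \<Rightarrow> real" where
  "level \<mu> s n \<omega> = stock (clip \<mu>) s (periods \<omega>) n"

definition peak :: "(real \<Rightarrow> real \<Rightarrow> real) \<Rightarrow> real \<Rightarrow> nat \<Rightarrow> 'a \<Rightarrow> real" where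
  "peak \<mu> s n \<omega> = min sbar (level \<mu> s n \<omega> + r * X n \<omega>)"

definition stage_cost :: "(real \<Rightarrow> real \<Rightarrow> real) \<Rightarrow> real \<Rightarrow> nat \<Rightarrow> 'a \<Rightarrow> real" where
  "stage_cost \<mu> s n \<omega> =
     discount_to (periods \<omega>) (Suc n) * g (W n \<omega> - \<mu> (peak \<mu> s n \<omega>) (W n \<omega>))"

text \<open>
  What the decision at arrival \<open>n\<close> costs beyond the best possible one: the advantage function of
  dynamic programming, up to sign, evaluated along the path.
\<close>

definition excess :: "(real \<Rightarrow> real \<Rightarrow> real) \<Rightarrow> real \<Rightarrow> nat \<Rightarrow> 'a \<Rightarrow> real" where
  "excess \<mu> s n \<omega> = discount_to (periods \<omega>) (Suc n) *
     (g (W n \<omega> - \<mu> (peak \<mu> s n \<omega>) (W n \<omega>)) + opt_value (level \<mu> s (Suc n) \<omega>)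
        - best_cost opt_value (peak \<mu> s n \<omega>) (W n \<omega>))"

lemma policiesD:
  assumes "\<mu> \<in> policies sbar B" "s \<in> {0..sbar}" "w \<in> {0..B}"
  shows "0 \<le> \<mu> s w" "\<mu> s w \<le> s" "\<mu> s w \<le> w"
  using assms by (auto simp: policies_def)

context
  fixes \<mu> s
  assumes \<mu>: "\<mu> \<in> policies sbar B" and s: "s \<in> {0..sbar}"
begin

lemma level_range: "\<omega> \<in> space M \<Longrightarrow> level \<mu> s n \<omega> \<in> {0..sbar}"
  and peak_range: "\<omega> \<in> space M \<Longrightarrow> peak \<mu> s n \<omega> \<in> {0..sbar}"
  and level_Suc: "\<omega> \<in> space M \<Longrightarrow>
    level \<mu> s (Suc n) \<omega> = peak \<mu> s n \<omega> - \<mu> (peak \<mu> s n \<omega>) (W n \<omega>)"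
proof -
  assume w: "\<omega> \<in> space M"
  have pk: "level \<mu> s n \<omega> \<in> {0..sbar} \<Longrightarrow> peak \<mu> s n \<omega> \<in> {0..sbar}" for n
    using gap_pos[OF w, of n] r_pos sbar_pos by (auto simp: peak_def)
  have nx: "level \<mu> s (Suc n) \<omega> = peak \<mu> s n \<omega> - \<mu> (peak \<mu> s n \<omega>) (W n \<omega>)"
    if "peak \<mu> s n \<omega> \<in> {0..sbar}" for n
    using that shock_range[OF w, of n]
    by (simp add: level_def peak_def Let_def periods_def clip_def)
  have lv: "level \<mu> s n \<omega> \<in> {0..sbar}" for n
  proof (induction n)
    case 0
    then show ?case using s by (simp add: level_def)
  next
    case (Suc n)
    then show ?case
      using nx[OF pk[OF Suc]] policiesD[OF \<mu> pk[OF Suc] shock_range[OF w, of n]] pk[OF Suc] by auto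
  qed
  show "level \<mu> s n \<omega> \<in> {0..sbar}" "peak \<mu> s n \<omega> \<in> {0..sbar}"
    "level \<mu> s (Suc n) \<omega> = peak \<mu> s n \<omega> - \<mu> (peak \<mu> s n \<omega>) (W n \<omega>)"
    using lv pk nx by auto
qed

lemma decision_range:
  assumes "\<omega> \<in> space M"
  shows "0 \<le> \<mu> (peak \<mu> s n \<omega>) (W n \<omega>)" "\<mu> (peak \<mu> s n \<omega>) (W n \<omega>) \<le> peak \<mu> s n \<omega>"
    "\<mu> (peak \<mu> s n \<omega>) (W n \<omega>) \<le> W n \<omega>"
  using policiesD[OF \<mu> peak_range shock_range, OF assms assms] by auto

lemma path_measurable [measurable]:
  "level \<mu> s n \<in> borel_measurable M" "peak \<mu> s n \<in> borel_measurable M"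
  "(\<lambda>\<omega>. discount_to (periods \<omega>) n) \<in> borel_measurable M"
proof -
  have *: "(\<lambda>\<omega>. (discount_to (periods \<omega>) n, level \<mu> s n \<omega>)) \<in> M \<rightarrow>\<^sub>M borel \<Otimes>\<^sub>M borel"
    using indep_var_rv1[OF past_indep_period[OF clip_measurable[OF \<mu>], of n s]] by (simp add: level_def)
  show l [measurable]: "level \<mu> s n \<in> borel_measurable M"
    using measurable_compose[OF * measurable_snd] by simp
  show "(\<lambda>\<omega>. discount_to (periods \<omega>) n) \<in> borel_measurable M"
    using measurable_compose[OF * measurable_fst] by simp
  show "peak \<mu> s n \<in> borel_measurable M"
    unfolding peak_def by measurable
qed

lemma shortage_measurable:
  "(\<lambda>\<omega>. g (W n \<omega> - \<mu> (peak \<mu> s n \<omega>) (W n \<omega>))) \<in> borel_measurable M"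
proof -
  have "(\<lambda>\<omega>. \<mu> (peak \<mu> s n \<omega>) (W n \<omega>)) \<in> borel_measurable M \<longleftrightarrow>
      (\<lambda>\<omega>. peak \<mu> s n \<omega> - level \<mu> s (Suc n) \<omega>) \<in> borel_measurable M"
    by (rule measurable_cong) (simp add: level_Suc)
  then have [measurable]: "(\<lambda>\<omega>. \<mu> (peak \<mu> s n \<omega>) (W n \<omega>)) \<in> borel_measurable M" by simp
  show ?thesis
  proof (rule borel_measurable_compose_on[of "{0..B}" g])
    show "continuous_on {0..B} g"
      using g_lipschitz by (rule lipschitz_on_continuous_on)
    show "W n \<omega> - \<mu> (peak \<mu> s n \<omega>) (W n \<omega>) \<in> {0..B}" if "\<omega> \<in> space M" for \<omega>
      using decision_range[OF that, of n] shock_range[OF that, of n] by auto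
  qed measurable
qed

lemma opt_value_level_measurable: "(\<lambda>\<omega>. opt_value (level \<mu> s n \<omega>)) \<in> borel_measurable M"
  using level_range opt_value_regular
  by (intro borel_measurable_compose_on[of "{0..sbar}" opt_value])
     (auto simp: regular_def intro: lipschitz_on_continuous_on)

lemma best_cost_peak_measurable:
  "(\<lambda>\<omega>. best_cost opt_value (peak \<mu> s n \<omega>) (W n \<omega>)) \<in> borel_measurable M"
  using peak_range shock_range by (intro best_cost_measurable opt_value_regular) auto

lemma integrable_discounted:
  assumes "h \<in> borel_measurable M" "\<And>\<omega>. \<omega> \<in> space M \<Longrightarrow> 0 \<le> h \<omega> \<and> h \<omega> \<le> K"
  shows "integrable M (\<lambda>\<omega>. discount_to (periods \<omega>) n * h \<omega>)"
proof (rule integrable_const_bound[where B = K])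
  show "AE \<omega> in M. norm (discount_to (periods \<omega>) n * h \<omega>) \<le> K"
  proof (rule AE_I2)
    fix \<omega> assume w: "\<omega> \<in> space M"
    have "discount_to (periods \<omega>) n * h \<omega> \<le> 1 * K"
      using discount_to_range[OF w] assms(2)[OF w] by (intro mult_mono) auto
    then show "norm (discount_to (periods \<omega>) n * h \<omega>) \<le> K"
      using discount_to_range[OF w, of n] assms(2)[OF w] by simp
  qed
qed (use assms(1) in measurable)

lemma expectation_discount_to: "(LINT \<omega>|M. discount_to (periods \<omega>) n) = \<rho> ^ n"
proof (induction n)
  case 0
  then show ?case by (simp add: discount_to_def prob_space)
next
  case (Suc n)
  let ?\<phi> = "\<lambda>(y::real) (p::real \<times> real). exp (- \<theta> * \<bar>fst p\<bar>)"
  have "(LINT \<omega>|M. discount_to (periods \<omega>) (Suc n)) =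
      (LINT \<omega>|M. discount_to (periods \<omega>) n * ?\<phi> (stock (clip \<mu>) s (periods \<omega>) n) (periods \<omega> n))"
    using gap_pos
    by (intro Bochner_Integration.integral_cong) (auto simp: discount_to_Suc periods_def less_imp_le)
  also have "\<dots> = (LINT \<omega>|M. discount_to (periods \<omega>) n *
      (LINT \<omega>'|M. ?\<phi> (stock (clip \<mu>) s (periods \<omega>) n) (periods \<omega>' 0)))"
    by (rule expectation_next_period[OF clip_measurable[OF \<mu>], where K = 1])
       (use \<theta>_pos in \<open>auto simp: mult_le_0_iff\<close>)
  also have "(LINT \<omega>'|M. exp (- \<theta> * \<bar>fst (periods \<omega>' 0)\<bar>)) = \<rho>"
    unfolding \<rho>_def using gap_pos
    by (intro Bochner_Integration.integral_cong) (auto simp: discount_def periods_def less_imp_le)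
  finally show ?case using Suc by simp
qed

text \<open>
  The Bellman equation at arrival \<open>n\<close>, averaged over the past.
\<close>

lemma expectation_best_cost:
  "(LINT \<omega>|M. discount_to (periods \<omega>) (Suc n) * best_cost opt_value (peak \<mu> s n \<omega>) (W n \<omega>)) =
   (LINT \<omega>|M. discount_to (periods \<omega>) n * opt_value (level \<mu> s n \<omega>))"
proof -
  let ?J = opt_value
  let ?b = "\<lambda>p. indicat_real ({0..sbar} \<times> {0..B}) p * case_prod (best_cost ?J) p"
  \<comment> \<open>The absolute value and the indicator in \<open>?b\<close> only make the integrand bounded and measurable
    everywhere; periods that occur have positive length and shocks in \<open>{0..B}\<close>.\<close>
  let ?\<phi> = "\<lambda>(y::real) p. exp (- \<theta> * \<bar>fst p\<bar>) * ?b (min sbar (y + r * fst p), snd p)"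
  have b [measurable]: "?b \<in> borel_measurable (borel \<Otimes>\<^sub>M borel)"
    using borel_measurable_continuous_on_indicator[OF _ best_cost_continuous[OF opt_value_regular]]
    by (simp add: borel_prod borel_closed closed_Times)
  have \<phi>: "(\<lambda>p. ?\<phi> (fst p) (snd p)) \<in> borel_measurable (borel \<Otimes>\<^sub>M (borel \<Otimes>\<^sub>M borel))"
  proof -
    have "(\<lambda>p. (min sbar (fst p + r * fst (snd p)), snd (snd p)))
        \<in> borel \<Otimes>\<^sub>M (borel \<Otimes>\<^sub>M borel) \<rightarrow>\<^sub>M (borel \<Otimes>\<^sub>M borel :: (real \<times> real) measure)"
      by measurable
    from measurable_compose[OF this b] show ?thesis by measurable
  qed
  have bound: "\<bar>?\<phi> y p\<bar> \<le> g B + cost_bound" for y p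
  proof -
    have "\<bar>?b q\<bar> \<le> g B + cost_bound" for q
      using best_cost_range[OF opt_value_candidate, of "fst q" "snd q"] cost_bound_nonneg g_nonneg[of B] B_pos
      by (auto simp: indicator_def split: prod.split)
    then have "\<bar>exp (- \<theta> * \<bar>fst p\<bar>)\<bar> * \<bar>?b (min sbar (y + r * fst p), snd p)\<bar> \<le> 1 * (g B + cost_bound)"
      using \<theta>_pos by (intro mult_mono) (auto simp: mult_le_0_iff)
    then show ?thesis by (simp add: abs_mult)
  qed
  have "(LINT \<omega>|M. discount_to (periods \<omega>) (Suc n) * best_cost ?J (peak \<mu> s n \<omega>) (W n \<omega>)) =
      (LINT \<omega>|M. discount_to (periods \<omega>) n * ?\<phi> (stock (clip \<mu>) s (periods \<omega>) n) (periods \<omega> n))"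
  proof (rule Bochner_Integration.integral_cong[OF refl])
    fix \<omega> assume w: "\<omega> \<in> space M"
    show "discount_to (periods \<omega>) (Suc n) * best_cost ?J (peak \<mu> s n \<omega>) (W n \<omega>) =
        discount_to (periods \<omega>) n * ?\<phi> (stock (clip \<mu>) s (periods \<omega>) n) (periods \<omega> n)"
      using peak_range[OF w, of n] shock_range[OF w, of n] gap_pos[OF w, of n]
      by (simp add: discount_to_Suc periods_def peak_def level_def indicator_def)
  qed
  also have "\<dots> = (LINT \<omega>|M. discount_to (periods \<omega>) n *
      (LINT \<omega>'|M. ?\<phi> (stock (clip \<mu>) s (periods \<omega>) n) (periods \<omega>' 0)))"
    by (rule expectation_next_period[OF clip_measurable[OF \<mu>] \<phi> bound])
  also have "\<dots> = (LINT \<omega>|M. discount_to (periods \<omega>) n * ?J (level \<mu> s n \<omega>))"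
  proof (rule Bochner_Integration.integral_cong[OF refl])
    fix \<omega> assume w: "\<omega> \<in> space M"
    let ?y = "level \<mu> s n \<omega>"
    have "(LINT \<omega>'|M. ?\<phi> ?y (periods \<omega>' 0)) = bellman ?J ?y"
      unfolding bellman_def
    proof (rule Bochner_Integration.integral_cong[OF refl])
      fix \<omega>' assume w': "\<omega>' \<in> space M"
      show "?\<phi> ?y (periods \<omega>' 0) = discount \<omega>' * best_cost ?J (refill ?y \<omega>') (W 0 \<omega>')"
        using refill_range[OF w' level_range[OF w, of n]] shock_range[OF w', of 0] gap_pos[OF w', of 0]
        by (simp add: discount_def refill_def periods_def indicator_def)
    qed
    then show "discount_to (periods \<omega>) n * (LINT \<omega>'|M. ?\<phi> (stock (clip \<mu>) s (periods \<omega>) n) (periods \<omega>' 0))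
        = discount_to (periods \<omega>) n * ?J ?y"
      using bellman_opt_value[OF level_range[OF w, of n]] by (simp add: level_def)
  qed
  finally show ?thesis .
qed

lemma shortage_range:
  assumes "\<omega> \<in> space M"
  shows "0 \<le> g (W n \<omega> - \<mu> (peak \<mu> s n \<omega>) (W n \<omega>))" "g (W n \<omega> - \<mu> (peak \<mu> s n \<omega>) (W n \<omega>)) \<le> g B"
  using decision_range[OF assms, of n] shock_range[OF assms, of n] by (auto intro!: g_nonneg g_le)

lemma stage_cost_nonneg: "\<omega> \<in> space M \<Longrightarrow> 0 \<le> stage_cost \<mu> s n \<omega>"
  unfolding stage_cost_def using shortage_range discount_to_range by (intro mult_nonneg_nonneg) (auto intro: less_imp_le)

lemma excess_nonneg: "\<omega> \<in> space M \<Longrightarrow> 0 \<le> excess \<mu> s n \<omega>"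
  unfolding excess_def
  using best_cost_le[OF opt_value_regular peak_range shock_range decision_range] discount_to_range(1)
  by (intro mult_nonneg_nonneg) (auto intro: less_imp_le simp: level_Suc)

lemma integrable_stage_cost: "integrable M (stage_cost \<mu> s n)"
  unfolding stage_cost_def using shortage_range shortage_measurable by (intro integrable_discounted) auto

lemma integrable_opt_value_level:
  "integrable M (\<lambda>\<omega>. discount_to (periods \<omega>) n * opt_value (level \<mu> s k \<omega>))"
  using level_range candidateD[OF opt_value_candidate] opt_value_level_measurable
  by (intro integrable_discounted) auto

lemma integrable_best_cost_peak:
  "integrable M (\<lambda>\<omega>. discount_to (periods \<omega>) n * best_cost opt_value (peak \<mu> s k \<omega>) (W k \<omega>))"
  using best_cost_range[OF opt_value_candidate peak_range shock_range] best_cost_peak_measurable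
  by (intro integrable_discounted) auto

lemma excess_eq:
  "excess \<mu> s n \<omega> = stage_cost \<mu> s n \<omega>
     + discount_to (periods \<omega>) (Suc n) * opt_value (level \<mu> s (Suc n) \<omega>)
     - discount_to (periods \<omega>) (Suc n) * best_cost opt_value (peak \<mu> s n \<omega>) (W n \<omega>)"
  by (simp add: excess_def stage_cost_def algebra_simps)

lemma integrable_excess: "integrable M (excess \<mu> s n)"
  unfolding excess_eq
  by (intro Bochner_Integration.integrable_add Bochner_Integration.integrable_diff
      integrable_stage_cost integrable_opt_value_level integrable_best_cost_peak)

lemma expectation_excess:
  "(LINT \<omega>|M. excess \<mu> s n \<omega>) = (LINT \<omega>|M. stage_cost \<mu> s n \<omega>)
     + (LINT \<omega>|M. discount_to (periods \<omega>) (Suc n) * opt_value (level \<mu> s (Suc n) \<omega>))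
     - (LINT \<omega>|M. discount_to (periods \<omega>) n * opt_value (level \<mu> s n \<omega>))"
  unfolding excess_eq using expectation_best_cost[of n]
  by (simp add: integrable_stage_cost integrable_opt_value_level integrable_best_cost_peak)

lemma integral_discounted_le:
  assumes "h \<in> borel_measurable M" "\<And>\<omega>. \<omega> \<in> space M \<Longrightarrow> 0 \<le> h \<omega> \<and> h \<omega> \<le> K"
  shows "(LINT \<omega>|M. discount_to (periods \<omega>) n * h \<omega>) \<le> \<rho> ^ n * K"
    "0 \<le> (LINT \<omega>|M. discount_to (periods \<omega>) n * h \<omega>)"
proof -
  have 1: "integrable M (\<lambda>\<omega>. discount_to (periods \<omega>) n)"
    using integrable_discounted[of "\<lambda>_. 1" 1 n] by simp
  have "(LINT \<omega>|M. discount_to (periods \<omega>) n * h \<omega>) \<le> (LINT \<omega>|M. discount_to (periods \<omega>) n * K)"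
    using integrable_discounted[OF assms] discount_to_range assms(2) 1
    by (intro integral_mono mult_left_mono) (auto intro: less_imp_le)
  then show "(LINT \<omega>|M. discount_to (periods \<omega>) n * h \<omega>) \<le> \<rho> ^ n * K"
    by (simp add: expectation_discount_to)
  show "0 \<le> (LINT \<omega>|M. discount_to (periods \<omega>) n * h \<omega>)"
    using discount_to_range assms(2)
    by (intro Bochner_Integration.integral_nonneg mult_nonneg_nonneg) (auto intro: less_imp_le)
qed

lemma summable_expectation_stage_cost: "summable (\<lambda>n. LINT \<omega>|M. stage_cost \<mu> s n \<omega>)"
proof (rule summable_comparison_test')
  show "summable (\<lambda>n. \<rho> ^ Suc n * g B)"
    using \<rho>_nonneg \<rho>_less_1 by (intro summable_mult2) (simp add: summable_geometric)
  show "norm (LINT \<omega>|M. stage_cost \<mu> s n \<omega>) \<le> \<rho> ^ Suc n * g B" for n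
    using integral_discounted_le[OF shortage_measurable, of n "g B" "Suc n"] shortage_range
    by (simp add: stage_cost_def)
qed

lemma stage_cost_measurable: "stage_cost \<mu> s n \<in> borel_measurable M"
  using integrable_stage_cost by auto

lemma AE_summable_stage_cost: "AE \<omega> in M. summable (\<lambda>n. norm (stage_cost \<mu> s n \<omega>))"
proof -
  note [measurable] = stage_cost_measurable
  have "(\<integral>\<^sup>+\<omega>. (\<Sum>n. ennreal (stage_cost \<mu> s n \<omega>)) \<partial>M) = (\<Sum>n. \<integral>\<^sup>+\<omega>. ennreal (stage_cost \<mu> s n \<omega>) \<partial>M)"
    by (rule nn_integral_suminf) measurable
  also have "\<dots> = (\<Sum>n. ennreal (LINT \<omega>|M. stage_cost \<mu> s n \<omega>))"
    using integrable_stage_cost stage_cost_nonneg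
    by (intro suminf_cong nn_integral_eq_integral) (auto intro!: AE_I2)
  also have "\<dots> < \<infinity>"
    using summable_expectation_stage_cost stage_cost_nonneg
    by (subst suminf_ennreal2) (auto intro!: Bochner_Integration.integral_nonneg)
  finally have "AE \<omega> in M. (\<Sum>n. ennreal (stage_cost \<mu> s n \<omega>)) \<noteq> \<infinity>"
    by (intro nn_integral_PInf_AE) auto
  then show ?thesis
    using AE_space
  proof eventually_elim
    case (elim \<omega>)
    then show ?case
      using stage_cost_nonneg by (intro summable_suminf_not_top) auto
  qed
qed

text \<open>
  By \<open>expectation_excess\<close> the expected excesses telescope: the first \<open>n\<close> of them sum up to the cost of
  the first \<open>n\<close> arrivals plus the discounted continuation cost after them, minus \<open>opt_value s\<close>. The
  continuation cost is bounded and its discount tends to 0.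
\<close>

lemma performance_difference:
  "(\<lambda>n. LINT \<omega>|M. excess \<mu> s n \<omega>) sums ((LINT \<omega>|M. (\<Sum>n. stage_cost \<mu> s n \<omega>)) - opt_value s)"
proof -
  let ?e = "\<lambda>n. LINT \<omega>|M. discount_to (periods \<omega>) n * opt_value (level \<mu> s n \<omega>)"
  have "norm (stage_cost \<mu> s n \<omega>) = stage_cost \<mu> s n \<omega>" if "\<omega> \<in> space M" for n \<omega>
    using stage_cost_nonneg[OF that, of n] by simp
  then have "(LINT \<omega>|M. norm (stage_cost \<mu> s n \<omega>)) = (LINT \<omega>|M. stage_cost \<mu> s n \<omega>)" for n
    by (intro Bochner_Integration.integral_cong) auto
  then have "(\<lambda>n. LINT \<omega>|M. stage_cost \<mu> s n \<omega>) sums (LINT \<omega>|M. (\<Sum>n. stage_cost \<mu> s n \<omega>))"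
    using summable_expectation_stage_cost
    by (intro sums_integral integrable_stage_cost AE_summable_stage_cost) simp
  then have A: "(\<lambda>n. \<Sum>k<n. LINT \<omega>|M. stage_cost \<mu> s k \<omega>) \<longlonglongrightarrow> (LINT \<omega>|M. (\<Sum>n. stage_cost \<mu> s n \<omega>))"
    by (simp add: sums_def)
  have B: "?e \<longlonglongrightarrow> 0"
  proof (rule tendsto_sandwich[OF _ _ tendsto_const \<rho>_power_tendsto[of cost_bound]])
    show "\<forall>\<^sub>F n in sequentially. 0 \<le> ?e n" "\<forall>\<^sub>F n in sequentially. ?e n \<le> \<rho> ^ n * cost_bound"
      using integral_discounted_le[OF opt_value_level_measurable, of n cost_bound n for n] level_range
        candidateD[OF opt_value_candidate]
      by (auto intro!: always_eventually)
  qed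
  have "?e 0 = opt_value s" by (simp add: discount_to_def level_def prob_space)
  then have "(\<Sum>k<n. LINT \<omega>|M. excess \<mu> s k \<omega>) = (\<Sum>k<n. LINT \<omega>|M. stage_cost \<mu> s k \<omega>) + ?e n - opt_value s" for n
    by (induction n) (simp_all add: expectation_excess)
  then show ?thesis
    using tendsto_diff[OF tendsto_add[OF A B] tendsto_const[of "opt_value s"]] by (simp add: sums_def)
qed

lemma opt_value_le_cost: "opt_value s \<le> (LINT \<omega>|M. (\<Sum>n. stage_cost \<mu> s n \<omega>))"
proof -
  have "0 \<le> (LINT \<omega>|M. (\<Sum>n. stage_cost \<mu> s n \<omega>)) - opt_value s"
    using excess_nonneg by (intro sums_le[OF _ sums_zero performance_difference] Bochner_Integration.integral_nonneg)
  then show ?thesis by simp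
qed

text \<open>
  A sum of nonnegative expectations vanishes only if each excess vanishes almost surely, and by
  uniqueness of the minimiser only the greedy decision has no excess.
\<close>

lemma optimal_iff_greedy:
  "(LINT \<omega>|M. (\<Sum>n. stage_cost \<mu> s n \<omega>)) = opt_value s \<longleftrightarrow>
   (AE \<omega> in M. \<forall>n. \<mu> (peak \<mu> s n \<omega>) (W n \<omega>) = greedy opt_value (peak \<mu> s n \<omega>) (W n \<omega>))"
proof -
  have greedy_iff: "excess \<mu> s n \<omega> = 0 \<longleftrightarrow> \<mu> (peak \<mu> s n \<omega>) (W n \<omega>) = greedy opt_value (peak \<mu> s n \<omega>) (W n \<omega>)"
    if w: "\<omega> \<in> space M" for n \<omega>
  proof -
    note R = opt_value_regular
    have "excess \<mu> s n \<omega> = 0 \<longleftrightarrow>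
        g (W n \<omega> - \<mu> (peak \<mu> s n \<omega>) (W n \<omega>)) + opt_value (peak \<mu> s n \<omega> - \<mu> (peak \<mu> s n \<omega>) (W n \<omega>))
          = best_cost opt_value (peak \<mu> s n \<omega>) (W n \<omega>)"
      using discount_to_range(1)[OF w, of "Suc n"] by (auto simp: excess_def level_Suc[OF w])
    also have "\<dots> \<longleftrightarrow> \<mu> (peak \<mu> s n \<omega>) (W n \<omega>) = greedy opt_value (peak \<mu> s n \<omega>) (W n \<omega>)"
      using greedy[OF R peak_range[OF w] shock_range[OF w]] decision_range[OF w]
        best_cost_unique_decision[OF R opt_value_strictly_convex peak_range[OF w] shock_range[OF w]]
      by metis
    finally show ?thesis .
  qed
  have "(LINT \<omega>|M. (\<Sum>n. stage_cost \<mu> s n \<omega>)) = opt_value s \<longleftrightarrow> (\<forall>n. (LINT \<omega>|M. excess \<mu> s n \<omega>) = 0)"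
  proof -
    have "(\<Sum>n. LINT \<omega>|M. excess \<mu> s n \<omega>) = 0 \<longleftrightarrow> (\<forall>n. (LINT \<omega>|M. excess \<mu> s n \<omega>) = 0)"
      using excess_nonneg performance_difference
      by (intro suminf_eq_zero_iff Bochner_Integration.integral_nonneg) (auto simp: sums_iff)
    then show ?thesis using performance_difference by (simp add: sums_iff)
  qed
  also have "\<dots> \<longleftrightarrow> (\<forall>n. AE \<omega> in M. excess \<mu> s n \<omega> = 0)"
    using excess_nonneg integrable_excess
    by (intro all_cong1 integral_nonneg_eq_0_iff_AE) (auto intro!: AE_I2)
  also have "\<dots> \<longleftrightarrow> (\<forall>n. AE \<omega> in M. \<mu> (peak \<mu> s n \<omega>) (W n \<omega>) = greedy opt_value (peak \<mu> s n \<omega>) (W n \<omega>))"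
    using greedy_iff by (intro all_cong1 AE_cong) auto
  also have "\<dots> \<longleftrightarrow> (AE \<omega> in M. \<forall>n. \<mu> (peak \<mu> s n \<omega>) (W n \<omega>) = greedy opt_value (peak \<mu> s n \<omega>) (W n \<omega>))"
    by (simp add: AE_all_countable)
  finally show ?thesis .
qed

end

section \<open>Optimal policies\<close>

context
  fixes T :: "nat \<Rightarrow> 'a \<Rightarrow> real"
  assumes gaps: "X = interarrival T"
begin

lemma arrival_time: "T k \<omega> = (\<Sum>j<Suc k. X j \<omega>)"
  by (induction k) (auto simp: gaps)

lemma random_level_eq_peak:
  assumes "\<mu> \<in> policies sbar B" "s \<in> {0..sbar}" "\<omega> \<in> space M"
  shows "random_level r sbar T W \<mu> s k \<omega> = peak \<mu> s k \<omega>"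
proof (induction k)
  case 0
  then show ?case by (simp add: peak_def level_def arrival_time)
next
  case (Suc k)
  then show ?case
    by (simp add: Let_def level_Suc[OF assms] peak_def[of \<mu> s "Suc k"] arrival_time)
qed

lemma policy_cost_eq_stage_costs:
  assumes "\<mu> \<in> policies sbar B" "s \<in> {0..sbar}"
  shows "policy_cost M r \<theta> sbar g T W \<mu> s = (LINT \<omega>|M. (\<Sum>k. stage_cost \<mu> s k \<omega>))"
proof -
  have "exp (- \<theta> * T k \<omega>) = discount_to (periods \<omega>) (Suc k)" for k \<omega>
    by (simp only: arrival_time discount_to_def periods_def fst_conv)
  then show ?thesis
    unfolding policy_cost_def stage_cost_def
    by (intro Bochner_Integration.integral_cong refl suminf_cong) (simp add: random_level_eq_peak[OF assms])
qed

lemma policy_cost_ge: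
  assumes "\<mu> \<in> policies sbar B" "s \<in> {0..sbar}"
  shows "opt_value s \<le> policy_cost M r \<theta> sbar g T W \<mu> s"
  using opt_value_le_cost[OF assms] by (simp add: policy_cost_eq_stage_costs[OF assms])

abbreviation optimum :: "real \<Rightarrow> real \<Rightarrow> real" where
  "optimum \<equiv> greedy opt_value"

lemma optimum_policy: "optimum \<in> policies sbar B"
  by (rule greedy_policy[OF opt_value_regular opt_value_strictly_convex])

lemma policy_cost_optimum:
  assumes "s \<in> {0..sbar}"
  shows "policy_cost M r \<theta> sbar g T W optimum s = opt_value s"
  using optimal_iff_greedy[OF optimum_policy assms]
  by (simp add: policy_cost_eq_stage_costs[OF optimum_policy assms])

lemma optimal_policy_optimum: "optimal_policy M r \<theta> sbar B g T W optimum"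
  unfolding optimal_policy_def is_arg_min_linorder
  by (intro conjI ballI allI impI optimum_policy) (simp add: policy_cost_optimum policy_cost_ge)

lemma optimal_policy_equivalent_optimum:
  assumes "optimal_policy M r \<theta> sbar B g T W \<mu>"
  shows "equivalent_policies M r sbar T W \<mu> optimum"
  unfolding equivalent_policies_def
proof
  fix s assume s: "s \<in> {0..sbar}"
  have \<mu>: "\<mu> \<in> policies sbar B" using assms by (simp add: optimal_policy_def)
  have "policy_cost M r \<theta> sbar g T W \<mu> s \<le> policy_cost M r \<theta> sbar g T W optimum s"
    using assms s optimum_policy unfolding optimal_policy_def is_arg_min_linorder by blast
  then have "policy_cost M r \<theta> sbar g T W \<mu> s \<le> opt_value s"
    by (simp only: policy_cost_optimum[OF s])
  then have "(LINT \<omega>|M. (\<Sum>n. stage_cost \<mu> s n \<omega>)) = opt_value s"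
    using policy_cost_ge[OF \<mu> s] by (simp add: policy_cost_eq_stage_costs[OF \<mu> s])
  then have "AE \<omega> in M. \<forall>k. \<mu> (peak \<mu> s k \<omega>) (W k \<omega>) = optimum (peak \<mu> s k \<omega>) (W k \<omega>)"
    by (simp add: optimal_iff_greedy[OF \<mu> s])
  then show "AE \<omega> in M. \<forall>k. \<mu> (random_level r sbar T W \<mu> s k \<omega>) (W k \<omega>) =
      optimum (random_level r sbar T W \<mu> s k \<omega>) (W k \<omega>)"
    using AE_space by eventually_elim (simp add: random_level_eq_peak[OF \<mu> s])
qed

text \<open>
  The continuation cost of any policy is at least \<open>opt_value\<close>, and that of the greedy policy equals it.
  So a policy that is as good as the greedy one at \<open>(s, w)\<close> minimises the same function of the
  decision there.
\<close>

lemma optimal_at_every_shock_eq_optimum: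
  assumes \<mu>: "\<mu> \<in> policies sbar B" and opt: "optimal_at_every_shock M r \<theta> sbar B g T W \<mu>"
    and s: "s \<in> {0..sbar}" and w: "w \<in> {0..B}"
  shows "\<mu> s w = optimum s w"
proof -
  note R = opt_value_regular and d = policiesD[OF \<mu> s w] and d' = greedy[OF R s w]
  have "g (w - \<mu> s w) + opt_value (s - \<mu> s w) \<le> cost_at_shock M r \<theta> sbar g T W \<mu> s w"
    unfolding cost_at_shock_def using policy_cost_ge[OF \<mu>, of "s - \<mu> s w"] d s by auto
  also have "\<dots> \<le> cost_at_shock M r \<theta> sbar g T W optimum s w"
    using opt s w optimum_policy unfolding optimal_at_every_shock_def is_arg_min_linorder by blast
  also have "\<dots> = best_cost opt_value s w"
    unfolding cost_at_shock_def using policy_cost_optimum[of "s - optimum s w"] d' s by auto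
  finally have le: "g (w - \<mu> s w) + opt_value (s - \<mu> s w) \<le> best_cost opt_value s w" .
  show ?thesis
    by (rule best_cost_unique_decision[OF R opt_value_strictly_convex s w])
       (use le best_cost_le[OF R s w d] d d' in auto)
qed

lemma optimal_policy_nondecreasing:
  assumes "optimal_policy M r \<theta> sbar B g T W \<mu>"
  shows "(\<exists>\<nu>. optimal_policy M r \<theta> sbar B g T W \<nu> \<and>
              equivalent_policies M r sbar T W \<mu> \<nu> \<and> nondecreasing_policy sbar B \<nu>) \<and>
         (optimal_at_every_shock M r \<theta> sbar B g T W \<mu> \<longrightarrow> nondecreasing_policy sbar B \<mu>)"
proof (intro conjI impI)
  have mono: "nondecreasing_policy sbar B optimum"
    by (rule greedy_nondecreasing[OF opt_value_regular opt_value_strictly_convex])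
  then show "\<exists>\<nu>. optimal_policy M r \<theta> sbar B g T W \<nu> \<and>
              equivalent_policies M r sbar T W \<mu> \<nu> \<and> nondecreasing_policy sbar B \<nu>"
    using optimal_policy_optimum optimal_policy_equivalent_optimum[OF assms] by blast
  assume "optimal_at_every_shock M r \<theta> sbar B g T W \<mu>"
  then have "\<mu> s w = optimum s w" if "s \<in> {0..sbar}" "w \<in> {0..B}" for s w
    using optimal_at_every_shock_eq_optimum that assms by (simp add: optimal_policy_def)
  then show "nondecreasing_policy sbar B \<mu>"
    using mono by (simp add: nondecreasing_policy_def monotone_on_def)
qed

end

end

section \<open>Poisson arrivals with independent shocks\<close>

text \<open>
  Two independent sequences of independent variables can be zipped: on rectangles the probabilities
  factor twice, and rectangles generate the product \<open>\<sigma>\<close>-algebra.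
\<close>

lemma (in prob_space) indep_vars_Pair:
  fixes X :: "'i \<Rightarrow> 'a \<Rightarrow> 'b" and Y :: "'i \<Rightarrow> 'a \<Rightarrow> 'b"
  assumes X: "indep_vars (\<lambda>_. S) X UNIV" and Y: "indep_vars (\<lambda>_. N) Y UNIV"
    and XY: "indep_var (PiM UNIV (\<lambda>_. S)) (\<lambda>\<omega> k. X k \<omega>) (PiM UNIV (\<lambda>_. N)) (\<lambda>\<omega> k. Y k \<omega>)"
  shows "indep_vars (\<lambda>_. S \<Otimes>\<^sub>M N) (\<lambda>k \<omega>. (X k \<omega>, Y k \<omega>)) UNIV"
proof -
  have [measurable]: "X k \<in> M \<rightarrow>\<^sub>M S" "Y k \<in> M \<rightarrow>\<^sub>M N" for k
    using X Y by (auto simp: indep_vars_def)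
  define G where "G k = {(X k -` A \<inter> space M) \<inter> (Y k -` C \<inter> space M) | A C. A \<in> sets S \<and> C \<in> sets N}" for k
  have "indep_sets G UNIV"
  proof (rule indep_setsI)
    show "G k \<subseteq> events" for k by (auto simp: G_def)
    fix E J assume J: "J \<noteq> {}" "finite J" and EG: "\<forall>j\<in>J. E j \<in> G j"
    have "\<forall>j\<in>J. \<exists>A C. A \<in> sets S \<and> C \<in> sets N \<and> E j = (X j -` A \<inter> space M) \<inter> (Y j -` C \<inter> space M)"
    proof
      fix j assume "j \<in> J"
      with EG have "E j \<in> G j" by blast
      then show "\<exists>A C. A \<in> sets S \<and> C \<in> sets N \<and> E j = (X j -` A \<inter> space M) \<inter> (Y j -` C \<inter> space M)"
        unfolding G_def by blast
    qed
    then obtain A C where [measurable]: "\<And>j. j \<in> J \<Longrightarrow> A j \<in> sets S" "\<And>j. j \<in> J \<Longrightarrow> C j \<in> sets N"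
      and E: "\<And>j. j \<in> J \<Longrightarrow> E j = (X j -` A j \<inter> space M) \<inter> (Y j -` C j \<inter> space M)"
      by metis
    let ?A = "{x \<in> space (PiM UNIV (\<lambda>_. S)). \<forall>j\<in>J. x j \<in> A j}"
    let ?C = "{x \<in> space (PiM UNIV (\<lambda>_. N)). \<forall>j\<in>J. x j \<in> C j}"
    have sets: "?A \<in> sets (PiM UNIV (\<lambda>_. S))" "?C \<in> sets (PiM UNIV (\<lambda>_. N))"
      using J by measurable
    have X_in: "(\<lambda>k. X k \<omega>) \<in> space (PiM UNIV (\<lambda>_. S))" "(\<lambda>k. Y k \<omega>) \<in> space (PiM UNIV (\<lambda>_. N))"
      if "\<omega> \<in> space M" for \<omega>
      using that measurable_space[of "X _" M S] measurable_space[of "Y _" M N] by (auto simp: space_PiM)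
    have "(\<Inter>j\<in>J. E j) = (\<lambda>\<omega>. (\<lambda>k. X k \<omega>, \<lambda>k. Y k \<omega>)) -` (?A \<times> ?C) \<inter> space M"
      using E X_in J by (auto simp: E)
    then have "prob (\<Inter>j\<in>J. E j) = prob ((\<lambda>\<omega> k. X k \<omega>) -` ?A \<inter> space M) * prob ((\<lambda>\<omega> k. Y k \<omega>) -` ?C \<inter> space M)"
      using indep_varD[OF XY sets] by simp
    also have "(\<lambda>\<omega> k. X k \<omega>) -` ?A \<inter> space M = (\<Inter>j\<in>J. X j -` A j \<inter> space M)"
      using X_in J by auto
    also have "(\<lambda>\<omega> k. Y k \<omega>) -` ?C \<inter> space M = (\<Inter>j\<in>J. Y j -` C j \<inter> space M)"
      using X_in J by auto
    also have "prob (\<Inter>j\<in>J. X j -` A j \<inter> space M) = (\<Prod>j\<in>J. prob (X j -` A j \<inter> space M))"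
      using J by (intro indep_varsD[OF X]) auto
    also have "prob (\<Inter>j\<in>J. Y j -` C j \<inter> space M) = (\<Prod>j\<in>J. prob (Y j -` C j \<inter> space M))"
      using J by (intro indep_varsD[OF Y]) auto
    also have "(\<Prod>j\<in>J. prob (X j -` A j \<inter> space M)) * (\<Prod>j\<in>J. prob (Y j -` C j \<inter> space M)) = (\<Prod>j\<in>J. prob (E j))"
      unfolding prod.distrib[symmetric]
    proof (rule prod.cong[OF refl])
      fix j assume j: "j \<in> J"
      let ?Aj = "{x \<in> space (PiM UNIV (\<lambda>_. S)). x j \<in> A j}"
      let ?Cj = "{x \<in> space (PiM UNIV (\<lambda>_. N)). x j \<in> C j}"
      have sets: "?Aj \<in> sets (PiM UNIV (\<lambda>_. S))" "?Cj \<in> sets (PiM UNIV (\<lambda>_. N))"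
        using j by measurable
      have "E j = (\<lambda>\<omega>. (\<lambda>k. X k \<omega>, \<lambda>k. Y k \<omega>)) -` (?Aj \<times> ?Cj) \<inter> space M"
        using E[OF j] X_in by auto
      moreover have "(\<lambda>\<omega> k. X k \<omega>) -` ?Aj \<inter> space M = X j -` A j \<inter> space M"
        "(\<lambda>\<omega> k. Y k \<omega>) -` ?Cj \<inter> space M = Y j -` C j \<inter> space M"
        using X_in by auto
      ultimately show "prob (X j -` A j \<inter> space M) * prob (Y j -` C j \<inter> space M) = prob (E j)"
        using indep_varD[OF XY sets] by simp
    qed
    finally show "prob (\<Inter>j\<in>J. E j) = (\<Prod>j\<in>J. prob (E j))" .
  qed
  then have "indep_sets (\<lambda>k. sigma_sets (space M) (G k)) UNIV"
  proof (rule indep_sets_sigma)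
    show "Int_stable (G k)" for k
    proof (rule Int_stableI)
      fix a b assume "a \<in> G k" "b \<in> G k"
      then obtain A C A' C' where "A \<in> sets S" "C \<in> sets N" "A' \<in> sets S" "C' \<in> sets N"
        "a = (X k -` A \<inter> space M) \<inter> (Y k -` C \<inter> space M)" "b = (X k -` A' \<inter> space M) \<inter> (Y k -` C' \<inter> space M)"
        by (auto simp: G_def)
      then show "a \<inter> b \<in> G k"
        unfolding G_def by (intro CollectI exI[of _ "A \<inter> A'"] exI[of _ "C \<inter> C'"]) auto
    qed
  qed
  moreover have "{(\<lambda>\<omega>. (X k \<omega>, Y k \<omega>)) -` A \<inter> space M | A. A \<in> sets (S \<Otimes>\<^sub>M N)} = sigma_sets (space M) (G k)" for k
  proof -
    have "(\<lambda>\<omega>. (X k \<omega>, Y k \<omega>)) \<in> space M \<rightarrow> space S \<times> space N"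
      by (auto intro: measurable_space[of "X _" M S] measurable_space[of "Y _" M N])
    then have "{(\<lambda>\<omega>. (X k \<omega>, Y k \<omega>)) -` A \<inter> space M | A. A \<in> sets (S \<Otimes>\<^sub>M N)} =
      sigma_sets (space M) {(\<lambda>\<omega>. (X k \<omega>, Y k \<omega>)) -` A \<inter> space M | A. A \<in> {a \<times> b | a b. a \<in> sets S \<and> b \<in> sets N}}"
      unfolding sets_pair_measure by (rule sigma_sets_vimage_commute)
    also have "{(\<lambda>\<omega>. (X k \<omega>, Y k \<omega>)) -` A \<inter> space M | A. A \<in> {a \<times> b | a b. a \<in> sets S \<and> b \<in> sets N}} = G k"
    proof -
      have "(\<lambda>\<omega>. (X k \<omega>, Y k \<omega>)) -` (a \<times> b) \<inter> space M = (X k -` a \<inter> space M) \<inter> (Y k -` b \<inter> space M)" for a b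
        by auto
      then have "G k = {(\<lambda>\<omega>. (X k \<omega>, Y k \<omega>)) -` (a \<times> b) \<inter> space M | a b. a \<in> sets S \<and> b \<in> sets N}"
        by (simp add: G_def)
      moreover have "{h A | A. A \<in> {a \<times> b | a b. a \<in> sets S \<and> b \<in> sets N}}
          = {h (a \<times> b) | a b. a \<in> sets S \<and> b \<in> sets N}" for h :: "('b \<times> 'b) set \<Rightarrow> 'a set"
        by blast
      ultimately show ?thesis by simp
    qed
    finally show ?thesis .
  qed
  ultimately show ?thesis by (simp add: indep_vars_def2)
qed

lemma interarrival_indep:
  assumes "prob_space M"
    and "prob_space.indep_var M
           (PiM UNIV (\<lambda>_. borel)) (\<lambda>\<omega> k. T k \<omega>) (PiM UNIV (\<lambda>_. borel)) (\<lambda>\<omega> k. W k \<omega>)"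
  shows "prob_space.indep_var M
           (PiM UNIV (\<lambda>_. borel)) (\<lambda>\<omega> k. interarrival T k \<omega>) (PiM UNIV (\<lambda>_. borel)) (\<lambda>\<omega> k. W k \<omega> :: real)"
proof -
  interpret prob_space M by fact
  let ?P = "PiM UNIV (\<lambda>_::nat. borel :: real measure)"
  let ?F = "\<lambda>(t :: nat \<Rightarrow> real) k. case k of 0 \<Rightarrow> t 0 | Suc j \<Rightarrow> t (Suc j) - t j"
  have "?F \<in> ?P \<rightarrow>\<^sub>M ?P"
  proof (rule measurable_abs_UNIV)
    show "(\<lambda>t. ?F t k) \<in> borel_measurable ?P" for k
      by (cases k) auto
  qed
  from indep_var_compose[OF assms(2) this measurable_ident]
  have "indep_var ?P (?F \<circ> (\<lambda>\<omega> k. T k \<omega>)) ?P (\<lambda>\<omega> k. W k \<omega>)"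
    by (simp add: o_def id_def)
  also have "?F \<circ> (\<lambda>\<omega> k. T k \<omega>) = (\<lambda>\<omega> k. interarrival T k \<omega>)"
    by (auto simp: fun_eq_iff split: nat.split)
  finally show ?thesis .
qed

lemma (in prob_space) exponential_interval_prob_pos:
  assumes D: "distributed M lborel X (\<lambda>x. ennreal (exponential_density l x))" and l: "0 < l"
    and ab: "0 \<le> a" "a < b"
  shows "0 < prob {\<omega> \<in> space M. a < X \<omega> \<and> X \<omega> < b}"
proof -
  define c where "c = (a + b) / 2"
  have c: "a < c" "c < b" using ab by (auto simp: c_def)
  have [measurable]: "X \<in> borel_measurable M"
    using D by (simp add: distributed_def)
  have "0 < exp (- a * l) - exp (- c * l)" using c l by simp
  also have "\<dots> = prob {\<omega> \<in> space M. a < X \<omega>} - prob {\<omega> \<in> space M. c < X \<omega>}"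
    using exponential_distributedD_gt[OF D _ l] ab c by simp
  also have "\<dots> = prob ({\<omega> \<in> space M. a < X \<omega>} - {\<omega> \<in> space M. c < X \<omega>})"
    using c by (intro finite_measure_Diff[symmetric]) auto
  also have "\<dots> \<le> prob {\<omega> \<in> space M. a < X \<omega> \<and> X \<omega> < b}"
    using c by (intro finite_measure_mono) auto
  finally show ?thesis .
qed

text \<open>
  Otherwise \<open>Y\<close> would stay below every \<open>1 / (n + 1)\<close> almost surely, so it would vanish.
\<close>

lemma (in prob_space) positive_with_positive_prob:
  fixes Y :: "'a \<Rightarrow> real"
  assumes [measurable]: "Y \<in> borel_measurable M" and nonneg: "\<And>\<omega>. \<omega> \<in> space M \<Longrightarrow> 0 \<le> Y \<omega>"
    and "g 0 = (0::real)" "(LINT \<omega>|M. g (Y \<omega>)) \<noteq> 0"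
  obtains c where "0 < c" "0 < prob {\<omega> \<in> space M. c \<le> Y \<omega>}"
proof (rule ccontr)
  assume "\<not> thesis"
  then have "prob {\<omega> \<in> space M. inverse (real (Suc n)) \<le> Y \<omega>} = 0" for n
    using that[of "inverse (real (Suc n))"] by (metis inverse_positive_iff_positive of_nat_0_less_iff
        zero_less_Suc zero_less_measure_iff)
  then have "AE \<omega> in M. \<not> inverse (real (Suc n)) \<le> Y \<omega>" for n
    by (subst (asm) prob_Collect_eq_0) auto
  then have "AE \<omega> in M. \<forall>n. \<not> inverse (real (Suc n)) \<le> Y \<omega>"
    by (simp add: AE_all_countable)
  then have "AE \<omega> in M. g (Y \<omega>) = 0"
    using AE_space
  proof eventually_elim
    case (elim \<omega>)
    then have "\<not> 0 < Y \<omega>" using reals_Archimedean[of "Y \<omega>"] by (metis less_imp_le)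
    then have "Y \<omega> = 0" using nonneg[of \<omega>] elim by simp
    then show ?case using assms by simp
  qed
  then have "(LINT \<omega>|M. g (Y \<omega>)) = 0" by (rule integral_eq_zero_AE)
  with assms show False by simp
qed

theorem theorem4:
  fixes M :: "'a measure" and T W :: "nat \<Rightarrow> 'a \<Rightarrow> real" and fW :: "real measure"
    and r Q \<theta> sbar B :: real and g :: "real \<Rightarrow> real" and \<mu> :: "real \<Rightarrow> real \<Rightarrow> real"
  assumes "prob_space M"
    and "r > 0" and "Q > 0" and "\<theta> > 0" and "sbar > 0" and "B > 0"
    and "poisson_arrival_times M Q T"
    and "iid_shocks M fW B W"
    and "prob_space.indep_var M
           (PiM UNIV (\<lambda>_. borel)) (\<lambda>\<omega> k. T k \<omega>) (PiM UNIV (\<lambda>_. borel)) (\<lambda>\<omega> k. W k \<omega>)"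
    and "bounded (g ` {0..B})" and "strict_mono_on {0..B} g"
    and "continuously_differentiable_on {0..B} g" and "convex_on {0..B} g" and "g 0 = 0"
    and "(LINT \<omega>|M. g (W 0 \<omega>)) > 0"
    and "continuously_differentiable_on {0..sbar} (value_function M r \<theta> sbar B g T W)"
    and "optimal_policy M r \<theta> sbar B g T W \<mu>"
    and "Q * (LINT \<omega>|M. W 0 \<omega>) \<le> r"
  shows "(\<exists>\<nu>. optimal_policy M r \<theta> sbar B g T W \<nu> \<and>
              equivalent_policies M r sbar T W \<mu> \<nu> \<and>
              nondecreasing_policy sbar B \<nu>) \<and>
         (optimal_at_every_shock M r \<theta> sbar B g T W \<mu> \<longrightarrow> nondecreasing_policy sbar B \<mu>)"
proof -
  interpret prob_space M by fact
  obtain L where L: "L-lipschitz_on {0..B} g"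
    using continuously_differentiable_lipschitz assms(12) by blast
  let ?X = "interarrival T"
  have X: "indep_vars (\<lambda>_. borel) ?X UNIV"
      "\<And>k. distributed M lborel (?X k) (\<lambda>x. ennreal (exponential_density Q x))"
      "\<And>\<omega> k. \<omega> \<in> space M \<Longrightarrow> 0 < ?X k \<omega>"
    subgoal using assms(7) by (simp add: poisson_arrival_times_def)
    subgoal using assms(7) by (simp add: poisson_arrival_times_def)
    subgoal for \<omega> k using assms(7) by (cases k) (auto simp: poisson_arrival_times_def)
    done
  have W: "indep_vars (\<lambda>_. borel) W UNIV" "\<And>k. distr M borel (W k) = fW"
      "\<And>\<omega> k. \<omega> \<in> space M \<Longrightarrow> W k \<omega> \<in> {0..B}"
    using assms(8) by (auto simp: iid_shocks_def)
  have [measurable]: "W k \<in> borel_measurable M" "?X k \<in> borel_measurable M" for k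
    using W(1) X(1) by (auto simp: indep_vars_def)
  note XW = interarrival_indep[OF assms(1,9)]
  have XWk: "indep_var borel (?X k) borel (W k)" for k
    using indep_var_compose[OF XW measurable_component_singleton measurable_component_singleton, of k k]
    by (simp add: o_def)
  have distr_X: "distr M borel (?X k) = density lborel (\<lambda>x. ennreal (exponential_density Q x))" for k
    using distributed_distr_eq_density[OF X(2)[of k]] by (metis distr_cong sets_lborel)
  obtain w\<^sub>0 where w0: "0 < w\<^sub>0" "0 < prob {\<omega> \<in> space M. w\<^sub>0 \<le> W 0 \<omega>}"
    using positive_with_positive_prob[of "W 0" g] W(3) assms(14,15) by auto
  interpret storage_process sbar B L g M ?X W r \<theta>
  proof
    show "indep_vars (\<lambda>_. borel \<Otimes>\<^sub>M borel) (\<lambda>k \<omega>. (?X k \<omega>, W k \<omega>)) UNIV"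
      by (rule indep_vars_Pair[OF X(1) W(1) XW])
    have "distr M (borel \<Otimes>\<^sub>M borel) (\<lambda>\<omega>. (?X k \<omega>, W k \<omega>)) =
        density lborel (\<lambda>x. ennreal (exponential_density Q x)) \<Otimes>\<^sub>M fW" for k
      using XWk[of k, unfolded indep_var_distribution_eq] distr_X[of k] W(2)[of k] by simp
    then show "distr M (borel \<Otimes>\<^sub>M borel) (\<lambda>\<omega>. (?X k \<omega>, W k \<omega>)) =
        distr M (borel \<Otimes>\<^sub>M borel) (\<lambda>\<omega>. (?X 0 \<omega>, W 0 \<omega>))" for k
      by (simp only:)
    have "\<not> (AE \<omega> in M. \<not> (a < ?X 0 \<omega> \<and> ?X 0 \<omega> < b \<and> w\<^sub>0 \<le> W 0 \<omega>))" if "0 \<le> a" "a < b" for a b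
    proof -
      have "prob {\<omega> \<in> space M. ?X 0 \<omega> \<in> {a<..<b} \<and> W 0 \<omega> \<in> {w\<^sub>0..}} =
          prob {\<omega> \<in> space M. ?X 0 \<omega> \<in> {a<..<b}} * prob {\<omega> \<in> space M. W 0 \<omega> \<in> {w\<^sub>0..}}"
        by (rule prob_indep_random_variable[OF XWk]) auto
      also have "\<dots> > 0"
        using exponential_interval_prob_pos[OF X(2) assms(3) that, of 0] w0 by simp
      finally have nz: "prob {\<omega> \<in> space M. a < ?X 0 \<omega> \<and> ?X 0 \<omega> < b \<and> w\<^sub>0 \<le> W 0 \<omega>} \<noteq> 0"
        by (simp add: conj_assoc)
      have ev: "{\<omega> \<in> space M. a < ?X 0 \<omega> \<and> ?X 0 \<omega> < b \<and> w\<^sub>0 \<le> W 0 \<omega>} \<in> events"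
        by measurable
      from prob_Collect_eq_0[OF ev] nz show ?thesis by blast
    qed
    with w0 show "\<exists>w\<^sub>0>0. \<forall>a b. 0 \<le> a \<longrightarrow> a < b \<longrightarrow>
        \<not> (AE \<omega> in M. \<not> (a < ?X 0 \<omega> \<and> ?X 0 \<omega> < b \<and> w\<^sub>0 \<le> W 0 \<omega>))" by blast
  qed (use assms L X(3) W(3) in auto)
  show ?thesis
    by (rule optimal_policy_nondecreasing[OF refl assms(17)])
qed

end
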